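(* Let $(M,\eta,H)$ be a smooth autonomous contact Hamiltonian system with $\dim M=3$, and let $\Phi:M\to M$ be a contact canonoid map for it. Set $X=X_H$, $\mu=\eta\wedge d\eta$, $\alpha=\Phi^*\eta$, $K=-\alpha(X)$, and define the function $\rho$ by $\Phi^*\mu=\rho\mu$, allowing $\rho$ to vanish. On $U=\{HK\neq0\}$ put $\lambda=-\eta/H$ and $$\Pi=\mathrm{id}_{TU}-X\otimes\lambda,\qquad \kappa=\rho\left(\frac HK\right)^2,$$ and let $N$ be the invariant endomorphism associated with $\Phi$ (defined in the context). Then on $U$ $$N=\kappa\,\Pi,\qquad \operatorname{tr}(N^k)=2\kappa^k,\qquad k\ge1.$$ In particular, these traces provide at most one functionally independent invariant.
   Context: A contact Hamiltonian system $(M^{2n+1},\eta,H)$ is a smooth manifold $M$ of dimension $2n+1$ (here $n=1$) with a contact form $\eta$ (i.e. $\eta\wedge(d\eta)^n$ is nowhere zero) and a smooth function $H$. The Reeb vector field $R$ is defined by $\eta(R)=1$, $\iota_Rd\eta=0$. The contact Hamiltonian vector field $X_H$ is defined by the convention $\eta(X_H)=-H$, $\iota_{X_H}d\eta=dH-R(H)\eta$. A smooth map $\Phi:M\to M$ is a contact canonoid map for $(M,\eta,H)$ if there exists $b\in C^\infty(M)$ with $\mathcal L_{X_H}(\Phi^*\eta)=-b\,\Phi^*\eta$. The endomorphism $N$: on $U=\{HK\ne0\}$ put $\lambda=-\eta/H$ and $\sigma=-\alpha/K$. Then $N:TU\to TU$ is the unique smooth bundle endomorphism such that $\lambda(NY)=0$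 and $d\lambda(NY,Z)=d\sigma(Y,Z)$ for all vector fields $Y,Z$ on $U$. Here $(X\otimes\lambda)(Y)=\lambda(Y)X$. "At most one functionally independent invariant" means that at each point of $U$ the differentials $d\operatorname{tr}(N^k)$, $k\ge1$, span a space of dimension at most $1$. *)

theory Defs
  imports "HOL-Analysis.Analysis"
begin

section \<open>Smooth functions between Euclidean spaces\<close>

text \<open>These notions are only used on open sets.\<close>

fun Ck_on :: "nat \<Rightarrow> 'e::euclidean_space set \<Rightarrow> ('e \<Rightarrow> 'f::real_normed_vector) \<Rightarrow> bool" where
  "Ck_on 0 S f \<longleftrightarrow> continuous_on S f"
| "Ck_on (Suc k) S f \<longleftrightarrow> (\<forall>x\<in>S. f differentiable (at x)) \<and>
     (\<forall>v. Ck_on k S (\<lambda>x. frechet_derivative f (at x) v))"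

definition smooth_on :: "'e::euclidean_space set \<Rightarrow> ('e \<Rightarrow> 'f::real_normed_vector) \<Rightarrow> bool" where
  "smooth_on S f \<longleftrightarrow> (\<forall>k. Ck_on k S f)"


section \<open>Smooth manifolds\<close>

text \<open>The manifold is the whole type \<open>'a\<close> (a Hausdorff second countable space, in the
  statements below), with the smooth structure given by an atlas. The values of a chart map outside
  its domain are irrelevant.\<close>

datatype ('a, 'n::finite) chart = Chart (cdom: "'a set") (cmap: "'a \<Rightarrow> real^'n")

definition cinv :: "('a, 'n::finite) chart \<Rightarrow> real^'n \<Rightarrow> 'a" where
  "cinv c = inv_into (cdom c) (cmap c)"

definition smooth_atlas :: "('a::topological_space, 'n::finite) chart set \<Rightarrow> bool" where
  "smooth_atlas A \<longleftrightarrow>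
     (\<Union>c\<in>A. cdom c) = UNIV \<and>
     (\<forall>c\<in>A. open (cdom c) \<and> open (cmap c ` cdom c) \<and>
        homeomorphism (cdom c) (cmap c ` cdom c) (cmap c) (cinv c)) \<and>
     (\<forall>c\<in>A. \<forall>d\<in>A. smooth_on (cmap c ` (cdom c \<inter> cdom d)) (cmap d \<circ> cinv c))"

definition charts_at :: "('a, 'n::finite) chart set \<Rightarrow> 'a \<Rightarrow> ('a, 'n) chart set" where
  "charts_at A p = {c \<in> A. p \<in> cdom c}"

text \<open>A choice of chart around each point. It is only used in definitions whose outcome does not
  depend on the chart.\<close>

definition chart_at :: "('a, 'n::finite) chart set \<Rightarrow> 'a \<Rightarrow> ('a, 'n) chart" where
  "chart_at A p = (SOME c. c \<in> charts_at A p)"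

definition smooth_function :: "('a, 'n::finite) chart set \<Rightarrow> ('a \<Rightarrow> real) \<Rightarrow> bool" where
  "smooth_function A f \<longleftrightarrow> (\<forall>c\<in>A. smooth_on (cmap c ` cdom c) (f \<circ> cinv c))"

definition smooth_map ::
  "('a::topological_space, 'n::finite) chart set \<Rightarrow> ('a \<Rightarrow> 'a) \<Rightarrow> bool" where
  "smooth_map A \<Phi> \<longleftrightarrow> continuous_on UNIV \<Phi> \<and>
     (\<forall>c\<in>A. \<forall>d\<in>A. smooth_on (cmap c ` (cdom c \<inter> \<Phi> -` cdom d)) (cmap d \<circ> \<Phi> \<circ> cinv c))"


section \<open>Tangent spaces\<close>

text \<open>A tangent vector at \<open>p\<close> is the family of its components in the charts around \<open>p\<close>; these are
  related by the derivatives of the transition maps. The component at any other chart is \<open>0\<close>, so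
  that equality of families is equality of tangent vectors. The linear structure is componentwise.\<close>

type_synonym ('a, 'n) tvec = "('a, 'n) chart \<Rightarrow> real^'n"

definition tangent_space :: "('a, 'n::finite) chart set \<Rightarrow> 'a \<Rightarrow> ('a, 'n) tvec set" where
  "tangent_space A p = {v.
     (\<forall>c\<in>charts_at A p. \<forall>d\<in>charts_at A p.
        v d = frechet_derivative (cmap d \<circ> cinv c) (at (cmap c p)) (v c)) \<and>
     (\<forall>c. c \<notin> charts_at A p \<longrightarrow> v c = 0)}"

definition tcomb :: "real \<Rightarrow> ('a, 'n::finite) tvec \<Rightarrow> real \<Rightarrow> ('a, 'n) tvec \<Rightarrow> ('a, 'n) tvec" where
  "tcomb a v b w = (\<lambda>c. a *\<^sub>R v c + b *\<^sub>R w c)"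

text \<open>The tangent vector at \<open>p\<close> whose component in the chart \<open>c\<close> is \<open>e\<close>.\<close>

definition coord_vec ::
  "('a, 'n::finite) chart set \<Rightarrow> ('a, 'n) chart \<Rightarrow> 'a \<Rightarrow> real^'n \<Rightarrow> ('a, 'n) tvec" where
  "coord_vec A c p e = (\<lambda>d. if d \<in> charts_at A p
     then frechet_derivative (cmap d \<circ> cinv c) (at (cmap c p)) e else 0)"

definition pushforward ::
  "('a, 'n::finite) chart set \<Rightarrow> ('a \<Rightarrow> 'a) \<Rightarrow> 'a \<Rightarrow> ('a, 'n) tvec \<Rightarrow> ('a, 'n) tvec" where
  "pushforward A \<Phi> p v = (let c = chart_at A p in
     (\<lambda>d. if d \<in> charts_at A (\<Phi> p)
       then frechet_derivative (cmap d \<circ> \<Phi> \<circ> cinv c) (at (cmap c p)) (v c) else 0))"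

definition vector_field ::
  "('a, 'n::finite) chart set \<Rightarrow> ('a \<Rightarrow> ('a, 'n) tvec) \<Rightarrow> bool" where
  "vector_field A X \<longleftrightarrow> (\<forall>p. X p \<in> tangent_space A p) \<and>
     (\<forall>c\<in>A. smooth_on (cmap c ` cdom c) (\<lambda>x. X (cinv c x) c))"


section \<open>Differential forms\<close>

type_synonym ('a, 'n) form1 = "'a \<Rightarrow> ('a, 'n) tvec \<Rightarrow> real"
type_synonym ('a, 'n) form2 = "'a \<Rightarrow> ('a, 'n) tvec \<Rightarrow> ('a, 'n) tvec \<Rightarrow> real"
type_synonym ('a, 'n) form3 =
  "'a \<Rightarrow> ('a, 'n) tvec \<Rightarrow> ('a, 'n) tvec \<Rightarrow> ('a, 'n) tvec \<Rightarrow> real"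

text \<open>The function \<open>\<omega>(E)\<close> read in the chart \<open>c\<close>, where \<open>E\<close> is the local vector field with constant
  component \<open>e\<close> in that chart.\<close>

definition local_form1 ::
  "('a, 'n::finite) chart set \<Rightarrow> ('a, 'n) chart \<Rightarrow> ('a, 'n) form1 \<Rightarrow> real^'n \<Rightarrow> real^'n \<Rightarrow> real" where
  "local_form1 A c \<omega> e = (\<lambda>x. \<omega> (cinv c x) (coord_vec A c (cinv c x) e))"

definition one_form :: "('a, 'n::finite) chart set \<Rightarrow> ('a, 'n) form1 \<Rightarrow> bool" where
  "one_form A \<omega> \<longleftrightarrow>
     (\<forall>p. \<forall>v\<in>tangent_space A p. \<forall>w\<in>tangent_space A p. \<forall>a b.
        \<omega> p (tcomb a v b w) = a * \<omega> p v + b * \<omega> p w) \<and>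
     (\<forall>c\<in>A. \<forall>e. smooth_on (cmap c ` cdom c) (local_form1 A c \<omega> e))"

definition differential ::
  "('a, 'n::finite) chart set \<Rightarrow> ('a \<Rightarrow> real) \<Rightarrow> ('a, 'n) form1" where
  "differential A f p v = (let c = chart_at A p in
     frechet_derivative (f \<circ> cinv c) (at (cmap c p)) (v c))"

text \<open>The formula \<open>d\<omega>(V, W) = V(\<omega>(W)) - W(\<omega>(V)) - \<omega>([V, W])\<close>, for \<open>V\<close> and \<open>W\<close> with constant
  components in a chart, so that \<open>[V, W] = 0\<close>. The value at \<open>p\<close> depends only on \<open>\<omega>\<close> near \<open>p\<close>, so it
  makes sense for a form that is smooth only on an open set containing \<open>p\<close>.\<close>

definition ext_d :: "('a, 'n::finite) chart set \<Rightarrow> ('a, 'n) form1 \<Rightarrow> ('a, 'n) form2" where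
  "ext_d A \<omega> p v w = (let c = chart_at A p in
     frechet_derivative (local_form1 A c \<omega> (w c)) (at (cmap c p)) (v c)
     - frechet_derivative (local_form1 A c \<omega> (v c)) (at (cmap c p)) (w c))"

text \<open>The formula \<open>(L\<^sub>X \<omega>)(V) = X(\<omega>(V)) - \<omega>([X, V])\<close>, for \<open>V\<close> with constant component \<open>v\<close> in a
  chart, so that \<open>[X, V]\<close> has the component \<open>- D X v\<close>.\<close>

definition lie_derivative ::
  "('a, 'n::finite) chart set \<Rightarrow> ('a \<Rightarrow> ('a, 'n) tvec) \<Rightarrow> ('a, 'n) form1 \<Rightarrow> ('a, 'n) form1" where
  "lie_derivative A X \<omega> p v = (let c = chart_at A p in
     frechet_derivative (local_form1 A c \<omega> (v c)) (at (cmap c p)) (X p c)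
     + \<omega> p (coord_vec A c p
         (frechet_derivative (\<lambda>x. X (cinv c x) c) (at (cmap c p)) (v c))))"

definition wedge12 :: "('a, 'n::finite) form1 \<Rightarrow> ('a, 'n) form2 \<Rightarrow> ('a, 'n) form3" where
  "wedge12 \<alpha> \<beta> p u v w = \<alpha> p u * \<beta> p v w + \<alpha> p v * \<beta> p w u + \<alpha> p w * \<beta> p u v"

definition pullback1 ::
  "('a, 'n::finite) chart set \<Rightarrow> ('a \<Rightarrow> 'a) \<Rightarrow> ('a, 'n) form1 \<Rightarrow> ('a, 'n) form1" where
  "pullback1 A \<Phi> \<omega> p v = \<omega> (\<Phi> p) (pushforward A \<Phi> p v)"

definition pullback3 ::
  "('a, 'n::finite) chart set \<Rightarrow> ('a \<Rightarrow> 'a) \<Rightarrow> ('a, 'n) form3 \<Rightarrow> ('a, 'n) form3" where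
  "pullback3 A \<Phi> \<omega> p u v w =
     \<omega> (\<Phi> p) (pushforward A \<Phi> p u) (pushforward A \<Phi> p v) (pushforward A \<Phi> p w)"


section \<open>Contact Hamiltonian systems in dimension three\<close>

definition contact_form :: "('a, 3) chart set \<Rightarrow> ('a, 3) form1 \<Rightarrow> bool" where
  "contact_form A \<eta> \<longleftrightarrow> one_form A \<eta> \<and>
     (\<forall>p. \<exists>u\<in>tangent_space A p. \<exists>v\<in>tangent_space A p. \<exists>w\<in>tangent_space A p.
        wedge12 \<eta> (ext_d A \<eta>) p u v w \<noteq> 0)"

definition contact_hamiltonian_system ::
  "('a::{t2_space, second_countable_topology}, 3) chart set \<Rightarrow> ('a, 3) form1 \<Rightarrow> ('a \<Rightarrow> real) \<Rightarrow> bool"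
where
  "contact_hamiltonian_system A \<eta> H \<longleftrightarrow>
     smooth_atlas A \<and> contact_form A \<eta> \<and> smooth_function A H"

definition reeb_field ::
  "('a, 3) chart set \<Rightarrow> ('a, 3) form1 \<Rightarrow> ('a \<Rightarrow> ('a, 3) tvec) \<Rightarrow> bool" where
  "reeb_field A \<eta> R \<longleftrightarrow> vector_field A R \<and>
     (\<forall>p. \<eta> p (R p) = 1 \<and> (\<forall>w\<in>tangent_space A p. ext_d A \<eta> p (R p) w = 0))"

text \<open>Reeb and contact Hamiltonian vector fields are unique, so they are introduced by their
  defining properties.\<close>

definition contact_hamiltonian_field ::
  "('a, 3) chart set \<Rightarrow> ('a, 3) form1 \<Rightarrow> ('a \<Rightarrow> real) \<Rightarrow> ('a \<Rightarrow> ('a, 3) tvec) \<Rightarrow> bool" where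
  "contact_hamiltonian_field A \<eta> H X \<longleftrightarrow> vector_field A X \<and>
     (\<exists>R. reeb_field A \<eta> R \<and>
       (\<forall>p. \<eta> p (X p) = - H p \<and>
         (\<forall>w\<in>tangent_space A p.
            ext_d A \<eta> p (X p) w = differential A H p w - differential A H p (R p) * \<eta> p w)))"

definition contact_canonoid ::
  "('a::topological_space, 3) chart set \<Rightarrow> ('a, 3) form1 \<Rightarrow> ('a \<Rightarrow> real) \<Rightarrow> ('a \<Rightarrow> 'a) \<Rightarrow> bool" where
  "contact_canonoid A \<eta> H \<Phi> \<longleftrightarrow> smooth_map A \<Phi> \<and>
     (\<exists>X b. contact_hamiltonian_field A \<eta> H X \<and> smooth_function A b \<and>
       (\<forall>p. \<forall>v\<in>tangent_space A p.
          lie_derivative A X (pullback1 A \<Phi> \<eta>) p v = - b p * pullback1 A \<Phi> \<eta> p v))"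


section \<open>Endomorphisms of the tangent bundle and their invariants\<close>

definition smooth_bundle_endo ::
  "('a, 'n::finite) chart set \<Rightarrow> 'a set \<Rightarrow> ('a \<Rightarrow> ('a, 'n) tvec \<Rightarrow> ('a, 'n) tvec) \<Rightarrow> bool" where
  "smooth_bundle_endo A U N \<longleftrightarrow>
     (\<forall>p\<in>U. \<forall>v\<in>tangent_space A p. N p v \<in> tangent_space A p \<and>
        (\<forall>w\<in>tangent_space A p. \<forall>a b. N p (tcomb a v b w) = tcomb a (N p v) b (N p w))) \<and>
     (\<forall>c\<in>A. \<forall>e. smooth_on (cmap c ` (cdom c \<inter> U))
        (\<lambda>x. N (cinv c x) (coord_vec A c (cinv c x) e) c))"

definition invariant_endo ::
  "('a, 'n::finite) chart set \<Rightarrow> 'a set \<Rightarrow> ('a, 'n) form1 \<Rightarrow> ('a, 'n) form1 \<Rightarrow>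
     ('a \<Rightarrow> ('a, 'n) tvec \<Rightarrow> ('a, 'n) tvec) \<Rightarrow> bool" where
  "invariant_endo A U lam \<sigma> N \<longleftrightarrow> smooth_bundle_endo A U N \<and>
     (\<forall>p\<in>U. \<forall>y\<in>tangent_space A p. lam p (N p y) = 0 \<and>
        (\<forall>z\<in>tangent_space A p. ext_d A lam p (N p y) z = ext_d A \<sigma> p y z))"

definition endo_trace ::
  "('a, 'n::finite) chart set \<Rightarrow> 'a \<Rightarrow> (('a, 'n) tvec \<Rightarrow> ('a, 'n) tvec) \<Rightarrow> real" where
  "endo_trace A p L = (let c = chart_at A p in trace (matrix (\<lambda>e. L (coord_vec A c p e) c)))"

text \<open>The dimension of the span of the differentials at \<open>p\<close> of a set of functions; the cotangent
  space is identified with \<open>real^'n\<close> by a dual coordinate basis.\<close>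

definition covector_components ::
  "('a, 'n::finite) chart set \<Rightarrow> 'a \<Rightarrow> (('a, 'n) tvec \<Rightarrow> real) \<Rightarrow> real^'n" where
  "covector_components A p \<theta> = (\<chi> i. \<theta> (coord_vec A (chart_at A p) p (axis i 1)))"

definition rank_of_differentials ::
  "('a, 'n::finite) chart set \<Rightarrow> 'a \<Rightarrow> ('a \<Rightarrow> real) set \<Rightarrow> nat" where
  "rank_of_differentials A p F = dim ((\<lambda>f. covector_components A p (differential A f p)) ` F)"

end

theory Submission
  imports Defs
begin

text \<open>The form \<open>\<lambda> = -\<eta>/H\<close> satisfies \<open>\<lambda>(X) = 1\<close> and \<open>\<iota>\<^sub>X d\<lambda> = 0\<close> by the definition of \<open>X\<close>, and the
  canonoid condition gives \<open>\<sigma>(X) = 1\<close> and \<open>\<iota>\<^sub>X d\<sigma> = 0\<close> by Cartan's formula: \<open>X\<close> is the Reeb field of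
  both. Since \<open>\<lambda> \<and> d\<lambda> = \<mu>/H\<^sup>2\<close> and \<open>\<sigma> \<and> d\<sigma> = \<Phi>\<^sup>*\<mu>/K\<^sup>2\<close>, it follows that
  \<open>\<sigma> \<and> d\<sigma> = \<kappa> \<lambda> \<and> d\<lambda>\<close>, and contracting with \<open>X\<close> yields \<open>d\<sigma> = \<kappa> d\<lambda>\<close>. As \<open>\<lambda>\<close> is a contact form, this
  determines \<open>N\<close>. In a chart, forms in dimension three are vectors: a 1-form is \<open>h \<bullet> v\<close> and a 2-form
  is \<open>b \<bullet> cross3 v w\<close>.\<close>

section \<open>Symmetry of second derivatives\<close>

lemma smooth_on_differentiable:
  assumes "smooth_on S f" "x \<in> S"
  shows "f differentiable (at x)"
proof -
  have "Ck_on (Suc 0) S f"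
    using assms(1) by (simp only: smooth_on_def)
  then show ?thesis
    using assms(2) by simp
qed

lemma smooth_on_has_derivative:
  assumes "smooth_on S f" "x \<in> S"
  shows "(f has_derivative frechet_derivative f (at x)) (at x)"
  using smooth_on_differentiable[OF assms] frechet_derivative_works by blast

lemma smooth_on_frechet_derivative:
  assumes "smooth_on S f"
  shows "smooth_on S (\<lambda>x. frechet_derivative f (at x) v)"
  unfolding smooth_on_def
proof
  fix k
  have "Ck_on (Suc k) S f"
    using assms by (simp only: smooth_on_def)
  then show "Ck_on k S (\<lambda>x. frechet_derivative f (at x) v)"
    by simp
qed

lemma smooth_on_continuous_on:
  assumes "smooth_on S f"
  shows "continuous_on S f"
  using assms unfolding smooth_on_def by (metis Ck_on.simps(1))

text \<open>The mean value theorem is applied twice: in direction \<open>u\<close> to the increment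
  along \<open>v\<close>, then in direction \<open>v\<close> to \<open>f' _ u\<close>. The left side
  is symmetric in \<open>u\<close> and \<open>v\<close>, while the right side involves only the
  derivative of the \<open>u\<close>-derivative.\<close>

lemma second_difference_eq:
  fixes f :: "'e::real_normed_vector \<Rightarrow> real"
  assumes f: "\<And>y. y \<in> S \<Longrightarrow> (f has_derivative f' y) (at y)"
    and g: "\<And>y. y \<in> S \<Longrightarrow> ((\<lambda>y. f' y u) has_derivative g y) (at y)"
    and "0 < h"
    and S: "\<And>s t. 0 \<le> s \<Longrightarrow> s \<le> h \<Longrightarrow> 0 \<le> t \<Longrightarrow> t \<le> h \<Longrightarrow> x + s *\<^sub>R u + t *\<^sub>R v \<in> S"
  shows "\<exists>s t. 0 \<le> s \<and> s \<le> h \<and> 0 \<le> t \<and> t \<le> h \<and>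
    f (x + h *\<^sub>R u + h *\<^sub>R v) - f (x + h *\<^sub>R u) - f (x + h *\<^sub>R v) + f x
      = h * (h * g (x + s *\<^sub>R u + t *\<^sub>R v) v)"
proof -
  have D: "((\<lambda>s. f (x + s *\<^sub>R u + t *\<^sub>R v)) has_real_derivative f' (x + s *\<^sub>R u + t *\<^sub>R v) u) (at s)"
    if "0 \<le> s" "s \<le> h" "0 \<le> t" "t \<le> h" for s t
  proof -
    have *: "(f has_derivative f' (x + s *\<^sub>R u + t *\<^sub>R v)) (at (x + s *\<^sub>R u + t *\<^sub>R v))"
      using f S that by blast
    have "((\<lambda>s. x + s *\<^sub>R u + t *\<^sub>R v) has_derivative (\<lambda>r. r *\<^sub>R u)) (at s)"
      by (auto intro!: derivative_eq_intros)
    from has_derivative_compose[OF this *]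
    have "((\<lambda>s. f (x + s *\<^sub>R u + t *\<^sub>R v)) has_derivative (\<lambda>r. f' (x + s *\<^sub>R u + t *\<^sub>R v) (r *\<^sub>R u))) (at s)" .
    then show ?thesis
      using linear_scale[OF has_derivative_linear[OF *]]
      by (simp add: has_field_derivative_def mult_commute_abs)
  qed
  \<comment> \<open>The summand \<open>0 *\<^sub>R v\<close> is kept so that both terms are
    instances of \<open>D\<close>.\<close>
  define \<phi> where "\<phi> = (\<lambda>s. f (x + s *\<^sub>R u + h *\<^sub>R v) - f (x + s *\<^sub>R u + 0 *\<^sub>R v))"
  have "\<exists>s. 0 < s \<and> s < h \<and> \<phi> h - \<phi> 0 =
      (h - 0) * (f' (x + s *\<^sub>R u + h *\<^sub>R v) u - f' (x + s *\<^sub>R u + 0 *\<^sub>R v) u)"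
    unfolding \<phi>_def using \<open>0 < h\<close> by (intro MVT2 DERIV_diff D) auto
  then obtain s where s: "0 < s" "s < h"
    and 1: "\<phi> h - \<phi> 0 = h * (f' (x + s *\<^sub>R u + h *\<^sub>R v) u - f' (x + s *\<^sub>R u + 0 *\<^sub>R v) u)"
    by auto
  have E: "((\<lambda>t. f' (x + s *\<^sub>R u + t *\<^sub>R v) u) has_real_derivative g (x + s *\<^sub>R u + t *\<^sub>R v) v) (at t)"
    if "0 \<le> t" "t \<le> h" for t
  proof -
    have *: "((\<lambda>y. f' y u) has_derivative g (x + s *\<^sub>R u + t *\<^sub>R v)) (at (x + s *\<^sub>R u + t *\<^sub>R v))"
      using g S s that by simp
    have "((\<lambda>t. x + s *\<^sub>R u + t *\<^sub>R v) has_derivative (\<lambda>r. r *\<^sub>R v)) (at t)"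
      by (auto intro!: derivative_eq_intros)
    from has_derivative_compose[OF this *]
    have "((\<lambda>t. f' (x + s *\<^sub>R u + t *\<^sub>R v) u) has_derivative (\<lambda>r. g (x + s *\<^sub>R u + t *\<^sub>R v) (r *\<^sub>R v))) (at t)" .
    then show ?thesis
      using linear_scale[OF has_derivative_linear[OF *]]
      by (simp add: has_field_derivative_def mult_commute_abs)
  qed
  have "\<exists>t. 0 < t \<and> t < h \<and> f' (x + s *\<^sub>R u + h *\<^sub>R v) u - f' (x + s *\<^sub>R u + 0 *\<^sub>R v) u =
      (h - 0) * g (x + s *\<^sub>R u + t *\<^sub>R v) v"
    using \<open>0 < h\<close> by (intro MVT2 E) auto
  then obtain t where t: "0 < t" "t < h"
    and 2: "f' (x + s *\<^sub>R u + h *\<^sub>R v) u - f' (x + s *\<^sub>R u + 0 *\<^sub>R v) u =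
      h * g (x + s *\<^sub>R u + t *\<^sub>R v) v"
    by auto
  have "f (x + h *\<^sub>R u + h *\<^sub>R v) - f (x + h *\<^sub>R u) - f (x + h *\<^sub>R v) + f x = \<phi> h - \<phi> 0"
    by (simp add: \<phi>_def)
  also have "\<dots> = h * (h * g (x + s *\<^sub>R u + t *\<^sub>R v) v)"
    unfolding 1 2 ..
  finally show ?thesis
    using s t by (intro exI[of _ s] exI[of _ t]) auto
qed

text \<open>Divided by the square of \<open>h\<close>, the same second difference is close to each
  of the two mixed derivatives. Regularity is asked only of derivatives in fixed directions, the
  form in which \<open>Ck_on\<close> supplies it.\<close>

lemma second_derivative_symmetric_real:
  fixes f :: "'e::real_normed_vector \<Rightarrow> real"
  assumes f: "\<And>y. y \<in> S \<Longrightarrow> (f has_derivative f' y) (at y)"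
    and gu: "\<And>y. y \<in> S \<Longrightarrow> ((\<lambda>y. f' y u) has_derivative gu y) (at y)"
    and gv: "\<And>y. y \<in> S \<Longrightarrow> ((\<lambda>y. f' y v) has_derivative gv y) (at y)"
    and cu: "isCont (\<lambda>y. gu y v) x" and cv: "isCont (\<lambda>y. gv y u) x"
    and S: "open S" "x \<in> S"
  shows "gu x v = gv x u"
proof (rule ccontr)
  assume "gu x v \<noteq> gv x u"
  define e where "e = \<bar>gu x v - gv x u\<bar> / 2"
  then have "e > 0"
    using \<open>gu x v \<noteq> gv x u\<close> by simp
  obtain d0 where d0: "d0 > 0" "\<And>y. dist y x < d0 \<Longrightarrow> y \<in> S"
    using S by (auto simp: open_dist)
  obtain d1 where d1: "d1 > 0" "\<And>y. dist y x < d1 \<Longrightarrow> dist (gu y v) (gu x v) < e"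
    using cu \<open>e > 0\<close> unfolding continuous_at_eps_delta by blast
  obtain d2 where d2: "d2 > 0" "\<And>y. dist y x < d2 \<Longrightarrow> dist (gv y u) (gv x u) < e"
    using cv \<open>e > 0\<close> unfolding continuous_at_eps_delta by blast
  define d where "d = min d0 (min d1 d2)"
  \<comment> \<open>The parallelogram with sides \<open>h *\<^sub>R u\<close> and
    \<open>h *\<^sub>R v\<close> then stays within distance \<open>d\<close> of \<open>x\<close>;
    the summand 1 keeps the denominator positive and the estimate strict.\<close>
  define h where "h = d / (norm u + norm v + 1)"
  have pos: "norm u + norm v + 1 > 0"
    using norm_ge_zero[of u] norm_ge_zero[of v] by linarith
  have "d > 0" "h > 0"
    using d0 d1 d2 pos by (auto simp: d_def h_def)
  have near: "dist (x + s *\<^sub>R u + t *\<^sub>R v) x < d" if "0 \<le> s" "s \<le> h" "0 \<le> t" "t \<le> h" for s t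
  proof -
    have "dist (x + s *\<^sub>R u + t *\<^sub>R v) x = norm (s *\<^sub>R u + t *\<^sub>R v)"
      by (simp add: dist_norm add.assoc)
    also have "\<dots> \<le> s * norm u + t * norm v"
      using that by (intro norm_triangle_le) auto
    also have "\<dots> \<le> h * norm u + h * norm v"
      using that by (intro add_mono mult_right_mono) auto
    also have "\<dots> < h * (norm u + norm v + 1)"
      using \<open>h > 0\<close> by (simp add: algebra_simps)
    also have "\<dots> = d"
      using pos by (simp add: h_def)
    finally show ?thesis .
  qed
  have inS: "x + s *\<^sub>R u + t *\<^sub>R v \<in> S" if "0 \<le> s" "s \<le> h" "0 \<le> t" "t \<le> h" for s t
    using near[OF that] d0 by (simp add: d_def)
  obtain s t where st: "0 \<le> s" "s \<le> h" "0 \<le> t" "t \<le> h" and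
    1: "f (x + h *\<^sub>R u + h *\<^sub>R v) - f (x + h *\<^sub>R u) - f (x + h *\<^sub>R v) + f x
      = h * (h * gu (x + s *\<^sub>R u + t *\<^sub>R v) v)"
    using second_difference_eq[where f = f and f' = f' and g = gu and u = u and v = v and x = x,
        OF f gu \<open>h > 0\<close> inS] by blast
  have inS': "x + s *\<^sub>R v + t *\<^sub>R u \<in> S" if "0 \<le> s" "s \<le> h" "0 \<le> t" "t \<le> h" for s t
    using inS[OF that(3,4,1,2)] by (simp add: algebra_simps)
  obtain s' t' where st': "0 \<le> s'" "s' \<le> h" "0 \<le> t'" "t' \<le> h" and
    2: "f (x + h *\<^sub>R v + h *\<^sub>R u) - f (x + h *\<^sub>R v) - f (x + h *\<^sub>R u) + f x
      = h * (h * gv (x + s' *\<^sub>R v + t' *\<^sub>R u) u)"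
    using second_difference_eq[where f = f and f' = f' and g = gv and u = v and v = u and x = x,
        OF f gv \<open>h > 0\<close> inS'] by blast
  have "h * (h * gu (x + s *\<^sub>R u + t *\<^sub>R v) v) = h * (h * gv (x + t' *\<^sub>R u + s' *\<^sub>R v) u)"
    using 1 2 by (simp add: algebra_simps)
  then have "gu (x + s *\<^sub>R u + t *\<^sub>R v) v = gv (x + t' *\<^sub>R u + s' *\<^sub>R v) u"
    using \<open>h > 0\<close> by simp
  moreover have "dist (gu (x + s *\<^sub>R u + t *\<^sub>R v) v) (gu x v) < e"
    using near[OF st] by (intro d1) (simp add: d_def)
  moreover have "dist (gv (x + t' *\<^sub>R u + s' *\<^sub>R v) u) (gv x u) < e"
    using near[OF st'(3,4,1,2)] by (intro d2) (simp add: d_def)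
  \<comment> \<open>The common value would be closer than \<open>e\<close> to both mixed
    derivatives, which are \<open>2 * e\<close> apart.\<close>
  ultimately show False
    unfolding e_def dist_real_def by (smt (verit) field_sum_of_halves)
qed

text \<open>The real case is applied to each coordinate of \<open>f\<close>. This symmetry is what
  makes the exterior derivative commute with pullback.\<close>

lemma smooth_on_second_derivative_symmetric:
  fixes f :: "'e::euclidean_space \<Rightarrow> 'f::euclidean_space"
  assumes f: "smooth_on S f" and S: "open S" "x \<in> S"
  shows "frechet_derivative (\<lambda>y. frechet_derivative f (at y) u) (at x) v =
    frechet_derivative (\<lambda>y. frechet_derivative f (at y) v) (at x) u"
proof (rule euclidean_eqI)
  fix i :: 'f
  let ?g = "\<lambda>u x. frechet_derivative (\<lambda>y. frechet_derivative f (at y) u) (at x)"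
  have g: "((\<lambda>y. frechet_derivative f (at y) u \<bullet> i) has_derivative (\<lambda>v. ?g u y v \<bullet> i)) (at y)"
    if "y \<in> S" for u y
    using smooth_on_has_derivative[OF smooth_on_frechet_derivative[OF f] that]
    by (rule has_derivative_inner_left)
  have c: "isCont (\<lambda>y. ?g u y v \<bullet> i) x" for u v
  proof -
    have "continuous_on S (\<lambda>y. ?g u y v)"
      by (intro smooth_on_continuous_on smooth_on_frechet_derivative f)
    then have "isCont (\<lambda>y. ?g u y v) x"
      using S continuous_on_eq_continuous_at by blast
    then show ?thesis
      by (intro continuous_intros)
  qed
  show "?g u x v \<bullet> i = ?g v x u \<bullet> i"
    by (rule second_derivative_symmetric_real[where S = S and f = "\<lambda>y. f y \<bullet> i"
          and f' = "\<lambda>y v. frechet_derivative f (at y) v \<bullet> i" and u = u and v = v])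
      (use f S smooth_on_has_derivative g c in \<open>auto intro: has_derivative_inner_left\<close>)
qed


section \<open>Calculus in charts\<close>

lemma has_derivative_vec_lambda:
  fixes f :: "'n::finite \<Rightarrow> 'e::real_normed_vector \<Rightarrow> real"
  assumes "\<And>i. (f i has_derivative f' i) (at x)"
  shows "((\<lambda>x. \<chi> i. f i x) has_derivative (\<lambda>u. \<chi> i. f' i u)) (at x)"
  using assms
  by (subst has_derivative_componentwise_within) (auto simp: Basis_vec_def inner_axis)

lemma linear_functional_inner:
  assumes "linear (f :: real^'n \<Rightarrow> real)"
  shows "f = (\<lambda>u. (\<chi> i. f (axis i 1)) \<bullet> u)"
proof
  fix u
  interpret linear f by fact
  have "f u = f (\<Sum>i\<in>UNIV. u $ i *\<^sub>R axis i 1)"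
    using basis_expansion[of u] by (simp add: scalar_mult_eq_scaleR)
  also have "\<dots> = (\<chi> i. f (axis i 1)) \<bullet> u"
    by (simp add: sum scaleR inner_vec_def mult.commute)
  finally show "f u = (\<chi> i. f (axis i 1)) \<bullet> u" .
qed

lemma tcomb_apply: "tcomb a v b w c = a *\<^sub>R v c + b *\<^sub>R w c"
  by (simp add: tcomb_def)

section \<open>Charts and derivatives of transition maps\<close>

locale smooth_manifold =
  fixes A :: "('a::topological_space, 'n::finite) chart set"
  assumes atlas: "smooth_atlas A"
begin

lemma charts_atD:
  assumes "c \<in> charts_at A p"
  shows "c \<in> A" "p \<in> cdom c"
  using assms by (auto simp: charts_at_def)

lemma chart_at_in: "chart_at A p \<in> charts_at A p"
proof -
  have "\<exists>c. c \<in> charts_at A p"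
    using atlas unfolding smooth_atlas_def charts_at_def by blast
  then show ?thesis
    unfolding chart_at_def by (rule someI_ex)
qed

lemma chart_homeomorphism:
  assumes "c \<in> A"
  shows "homeomorphism (cdom c) (cmap c ` cdom c) (cmap c) (cinv c)"
  using atlas assms by (simp add: smooth_atlas_def)

lemma open_cdom: "c \<in> A \<Longrightarrow> open (cdom c)"
  and open_chart_image: "c \<in> A \<Longrightarrow> open (cmap c ` cdom c)"
  using atlas by (simp_all add: smooth_atlas_def)

lemma cinv_cmap: "c \<in> A \<Longrightarrow> p \<in> cdom c \<Longrightarrow> cinv c (cmap c p) = p"
  using chart_homeomorphism by (auto simp: homeomorphism_def)

lemma cmap_cinv: "c \<in> A \<Longrightarrow> x \<in> cmap c ` cdom c \<Longrightarrow> cmap c (cinv c x) = x"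
  using chart_homeomorphism by (auto simp: homeomorphism_def)

lemma cinv_in: "c \<in> A \<Longrightarrow> x \<in> cmap c ` cdom c \<Longrightarrow> cinv c x \<in> cdom c"
  using cinv_cmap by auto

lemma cinv_charts_at: "c \<in> A \<Longrightarrow> x \<in> cmap c ` cdom c \<Longrightarrow> c \<in> charts_at A (cinv c x)"
  using cinv_in by (auto simp: charts_at_def)

lemma open_chart_image_Int:
  assumes "c \<in> A" "open V"
  shows "open (cmap c ` (cdom c \<inter> V))"
proof -
  have "openin (top_of_set (cdom c)) (cdom c \<inter> V)"
    using assms(2) by (rule openin_open_Int)
  then have "openin (top_of_set (cmap c ` cdom c)) (cmap c ` (cdom c \<inter> V))"
    by (rule homeomorphism_imp_open_map[OF chart_homeomorphism[OF assms(1)]])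
  then show ?thesis
    using open_chart_image[OF assms(1)] by (rule openin_open_trans)
qed

lemma eventually_chart:
  assumes c: "c \<in> charts_at A p" and V: "open V" "p \<in> V"
    and P: "\<And>q. q \<in> cdom c \<Longrightarrow> q \<in> V \<Longrightarrow> P (cmap c q)"
  shows "\<forall>\<^sub>F x in nhds (cmap c p). P x"
  unfolding eventually_nhds
  using open_chart_image_Int[OF charts_atD(1)[OF c] V(1)] charts_atD[OF c] V(2) P
  by (intro exI[of _ "cmap c ` (cdom c \<inter> V)"]) auto

lemma eventually_in_chart:
  assumes "c \<in> charts_at A p"
  shows "\<forall>\<^sub>F x in nhds (cmap c p). x \<in> cmap c ` cdom c"
  using eventually_chart[OF assms open_UNIV, of "\<lambda>x. x \<in> cmap c ` cdom c"] by auto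

lemma transition_has_derivative:
  assumes "c \<in> charts_at A p" "d \<in> charts_at A p"
  shows "((cmap d \<circ> cinv c) has_derivative
    frechet_derivative (cmap d \<circ> cinv c) (at (cmap c p))) (at (cmap c p))"
proof (rule smooth_on_has_derivative)
  show "smooth_on (cmap c ` (cdom c \<inter> cdom d)) (cmap d \<circ> cinv c)"
    using atlas charts_atD(1)[OF assms(1)] charts_atD(1)[OF assms(2)] by (simp add: smooth_atlas_def)
  show "cmap c p \<in> cmap c ` (cdom c \<inter> cdom d)"
    using charts_atD(2)[OF assms(1)] charts_atD(2)[OF assms(2)] by auto
qed

lemma transition_derivative_self:
  assumes "c \<in> charts_at A p"
  shows "frechet_derivative (cmap c \<circ> cinv c) (at (cmap c p)) v = v"
proof -
  note c = charts_atD[OF assms]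
  have "((cmap c \<circ> cinv c) has_derivative (\<lambda>v. v)) (at (cmap c p))"
  proof (rule has_derivative_transform_within_open[OF has_derivative_ident])
    show "open (cmap c ` cdom c)"
      by (rule open_chart_image[OF c(1)])
  qed (use c cmap_cinv in auto)
  from frechet_derivative_at[OF this] show ?thesis
    by metis
qed

text \<open>With \<open>F = cmap e\<close> this is the cocycle rule for transitions, with \<open>F = cmap e \<circ> \<Phi>\<close> the chart
  independence of the pushforward.\<close>

lemma frechet_derivative_change_chart:
  assumes c: "c \<in> charts_at A p" and d: "d \<in> charts_at A p"
    and F: "(F \<circ> cinv d) differentiable at (cmap d p)"
  shows "frechet_derivative (F \<circ> cinv c) (at (cmap c p)) v =
    frechet_derivative (F \<circ> cinv d) (at (cmap d p))
      (frechet_derivative (cmap d \<circ> cinv c) (at (cmap c p)) v)"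
proof -
  note cA = charts_atD[OF c] and dA = charts_atD[OF d]
  have 1: "cmap d p = (cmap d \<circ> cinv c) (cmap c p)"
    by (simp add: cinv_cmap cA)
  have "((F \<circ> cinv d) \<circ> (cmap d \<circ> cinv c) has_derivative
     frechet_derivative (F \<circ> cinv d) (at (cmap d p)) \<circ>
      frechet_derivative (cmap d \<circ> cinv c) (at (cmap c p))) (at (cmap c p))"
    using diff_chain_at[OF transition_has_derivative[OF c d],
        of "F \<circ> cinv d" "frechet_derivative (F \<circ> cinv d) (at (cmap d p))"]
      F[unfolded frechet_derivative_works] unfolding 1 .
  \<comment> \<open>\<open>cinv d\<close> and \<open>cmap d\<close> cancel only on the overlap of
    the two chart domains; its image is open, which suffices for the derivative.\<close>
  moreover have "((F \<circ> cinv d) \<circ> (cmap d \<circ> cinv c)) x = (F \<circ> cinv c) x"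
    if "x \<in> cmap c ` (cdom c \<inter> cdom d)" for x
    using that by (auto simp: cinv_cmap cA dA)
  ultimately have "((F \<circ> cinv c) has_derivative
     frechet_derivative (F \<circ> cinv d) (at (cmap d p)) \<circ>
      frechet_derivative (cmap d \<circ> cinv c) (at (cmap c p))) (at (cmap c p))"
    using has_derivative_transform_within_open[of "(F \<circ> cinv d) \<circ> (cmap d \<circ> cinv c)" _ "cmap c p" UNIV
        "cmap c ` (cdom c \<inter> cdom d)" "F \<circ> cinv c"]
      open_chart_image_Int[OF cA(1) open_cdom[OF dA(1)]] cA(2) dA(2)
    by blast
  from frechet_derivative_at[OF this] show ?thesis
    by (metis comp_apply)
qed

lemma transition_derivative_compose:
  assumes "c \<in> charts_at A p" "d \<in> charts_at A p" "e \<in> charts_at A p"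
  shows "frechet_derivative (cmap e \<circ> cinv d) (at (cmap d p))
      (frechet_derivative (cmap d \<circ> cinv c) (at (cmap c p)) v) =
    frechet_derivative (cmap e \<circ> cinv c) (at (cmap c p)) v"
  using frechet_derivative_change_chart[OF assms(1,2), of "cmap e"]
    transition_has_derivative[OF assms(2,3)] by (simp add: differentiableI)

section \<open>Tangent vectors read in one chart\<close>

lemma coord_vec_in_tangent_space:
  assumes "c \<in> charts_at A p"
  shows "coord_vec A c p e \<in> tangent_space A p"
  unfolding tangent_space_def coord_vec_def
  using transition_derivative_compose[OF assms] by simp

lemma coord_vec_self:
  assumes "c \<in> charts_at A p"
  shows "coord_vec A c p e c = e"
  using assms by (simp add: coord_vec_def transition_derivative_self)

text \<open>The component in one chart around \<open>p\<close> determines those in the others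
  through the transitions, and the convention of value 0 at all remaining charts settles the rest of
  the family.\<close>

lemma tangent_vector_eqI:
  assumes "v \<in> tangent_space A p" "w \<in> tangent_space A p" "c \<in> charts_at A p" "v c = w c"
  shows "v = w"
proof
  fix d
  show "v d = w d"
  proof (cases "d \<in> charts_at A p")
    case True
    have "v d = frechet_derivative (cmap d \<circ> cinv c) (at (cmap c p)) (v c)"
      "w d = frechet_derivative (cmap d \<circ> cinv c) (at (cmap c p)) (w c)"
      using assms(1-3) True unfolding tangent_space_def by blast+
    then show ?thesis
      using assms(4) by simp
  next
    case False
    then have "v d = 0" "w d = 0"
      using assms(1,2) unfolding tangent_space_def by blast+
    then show ?thesis
      by simp
  qed
qed

text \<open>Together with \<open>coord_vec_self\<close> this identifies the tangent space at
  \<open>p\<close> with the coordinate space of any chart around \<open>p\<close>.\<close>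

lemma coord_vec_component:
  assumes "v \<in> tangent_space A p" "c \<in> charts_at A p"
  shows "coord_vec A c p (v c) = v"
  using assms coord_vec_in_tangent_space coord_vec_self tangent_vector_eqI by blast

lemma tcomb_in_tangent_space:
  assumes "v \<in> tangent_space A p" "w \<in> tangent_space A p"
  shows "tcomb a v b w \<in> tangent_space A p"
proof -
  have "tcomb a v b w d = frechet_derivative (cmap d \<circ> cinv c) (at (cmap c p)) (tcomb a v b w c)"
    if c: "c \<in> charts_at A p" and d: "d \<in> charts_at A p" for c d
  proof -
    interpret linear "frechet_derivative (cmap d \<circ> cinv c) (at (cmap c p))"
      using transition_has_derivative[OF c d] by (rule has_derivative_linear)
    have "v d = frechet_derivative (cmap d \<circ> cinv c) (at (cmap c p)) (v c)"
      "w d = frechet_derivative (cmap d \<circ> cinv c) (at (cmap c p)) (w c)"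
      using assms c d unfolding tangent_space_def by blast+
    then show ?thesis
      by (simp add: tcomb_def add scaleR)
  qed
  moreover have "tcomb a v b w c = 0" if "c \<notin> charts_at A p" for c
    using assms that by (simp add: tcomb_def tangent_space_def)
  ultimately show ?thesis
    unfolding tangent_space_def by blast
qed

lemma coord_vec_sum:
  assumes "c \<in> charts_at A p"
  shows "coord_vec A c p (a *\<^sub>R u + b *\<^sub>R v) = tcomb a (coord_vec A c p u) b (coord_vec A c p v)"
  by (rule tangent_vector_eqI[OF _ _ assms])
    (simp_all add: assms coord_vec_in_tangent_space tcomb_in_tangent_space coord_vec_self
      tcomb_apply)

section \<open>Coefficients and exterior derivatives of 1-forms\<close>

lemma form1_linear_coord:
  assumes \<omega>: "\<forall>p. \<forall>v\<in>tangent_space A p. \<forall>w\<in>tangent_space A p. \<forall>a b.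
        \<omega> p (tcomb a v b w) = a * \<omega> p v + b * (\<omega> p w::real)"
    and c: "c \<in> charts_at A p"
  shows "linear (\<lambda>e. \<omega> p (coord_vec A c p e))"
proof (rule linearI)
  have *: "\<omega> p (coord_vec A c p (a *\<^sub>R u + b *\<^sub>R v)) =
      a * \<omega> p (coord_vec A c p u) + b * \<omega> p (coord_vec A c p v)" for a b u v
    using \<omega> coord_vec_in_tangent_space[OF c] by (simp add: coord_vec_sum[OF c])
  show "\<omega> p (coord_vec A c p (u + v)) = \<omega> p (coord_vec A c p u) + \<omega> p (coord_vec A c p v)" for u v
    using *[of 1 u 1 v] by simp
  show "\<omega> p (coord_vec A c p (r *\<^sub>R u)) = r *\<^sub>R \<omega> p (coord_vec A c p u)" for r u
    using *[of r u 0 u] by simp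
qed

text \<open>\<open>local_coeffs \<omega> c p h h'\<close>: near \<open>p\<close> the form \<open>\<omega>\<close> is \<open>\<Sum>\<^sub>i h\<^sub>i dx\<^sub>i\<close> in the chart \<open>c\<close>, and \<open>h'\<close> is
  the derivative of \<open>h\<close> at \<open>p\<close>.\<close>

definition local_coeffs ::
  "('a, 'n) form1 \<Rightarrow> ('a, 'n) chart \<Rightarrow> 'a \<Rightarrow> (real^'n \<Rightarrow> real^'n) \<Rightarrow> (real^'n \<Rightarrow> real^'n) \<Rightarrow> bool" where
  "local_coeffs \<omega> c p h h' \<longleftrightarrow>
     (\<forall>\<^sub>F x in nhds (cmap c p). \<forall>e. local_form1 A c \<omega> e x = h x \<bullet> e) \<and>
     (h has_derivative h') (at (cmap c p))"

lemma local_coeffs_value: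
  assumes "local_coeffs \<omega> c p h h'" "c \<in> charts_at A p" "v \<in> tangent_space A p"
  shows "\<omega> p v = h (cmap c p) \<bullet> v c"
proof -
  have "\<forall>e. local_form1 A c \<omega> e (cmap c p) = h (cmap c p) \<bullet> e"
    using assms(1) unfolding local_coeffs_def by (blast dest: eventually_nhds_x_imp_x)
  then show ?thesis
    using assms(2,3) charts_atD[OF assms(2)] unfolding local_form1_def
    by (metis cinv_cmap coord_vec_component)
qed

lemma local_coeffs_has_derivative:
  assumes "local_coeffs \<omega> c p h h'"
  shows "(local_form1 A c \<omega> e has_derivative (\<lambda>u. h' u \<bullet> e)) (at (cmap c p))"
proof -
  from assms obtain S where S: "open S" "cmap c p \<in> S"
    "\<And>x e. x \<in> S \<Longrightarrow> local_form1 A c \<omega> e x = h x \<bullet> e"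
    unfolding local_coeffs_def eventually_nhds by blast
  have "((\<lambda>x. h x \<bullet> e) has_derivative (\<lambda>u. h' u \<bullet> e)) (at (cmap c p))"
    using assms unfolding local_coeffs_def by (blast intro: has_derivative_inner_left)
  then show ?thesis
    by (rule has_derivative_transform_within_open[OF _ S(1,2)]) (simp add: S(3))
qed

lemma ext_d_local_coeffs:
  assumes "local_coeffs \<omega> (chart_at A p) p h h'"
  shows "ext_d A \<omega> p v w =
    h' (v (chart_at A p)) \<bullet> w (chart_at A p) - h' (w (chart_at A p)) \<bullet> v (chart_at A p)"
  using frechet_derivative_at[OF local_coeffs_has_derivative[OF assms]]
  by (simp add: ext_d_def Let_def) metis

text \<open>The coefficients are the values on the coordinate fields, and \<open>one_form\<close>
  demands smoothness of exactly these local functions.\<close>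

lemma one_form_local_coeffs:
  assumes \<omega>: "one_form A \<omega>" and c: "c \<in> charts_at A p"
  obtains h h' where "local_coeffs \<omega> c p h h'"
proof -
  note cA = charts_atD[OF c]
  define h where "h = (\<lambda>x. \<chi> i. local_form1 A c \<omega> (axis i 1) x)"
  have "\<forall>e. local_form1 A c \<omega> e x = h x \<bullet> e" if x: "x \<in> cmap c ` cdom c" for x
  proof
    fix e :: "real^'n"
    have c': "c \<in> charts_at A (cinv c x)"
      using cA(1) x by (rule cinv_charts_at)
    have "linear (\<lambda>e. \<omega> (cinv c x) (coord_vec A c (cinv c x) e))"
      using \<omega> by (intro form1_linear_coord[OF _ c']) (simp add: one_form_def)
    from linear_functional_inner[OF this, THEN fun_cong, of e]
    show "local_form1 A c \<omega> e x = h x \<bullet> e"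
      by (simp add: h_def local_form1_def)
  qed
  then have 1: "\<forall>\<^sub>F x in nhds (cmap c p). \<forall>e. local_form1 A c \<omega> e x = h x \<bullet> e"
    using eventually_in_chart[OF c] by (simp add: eventually_mono)
  have "\<exists>h'. (h has_derivative h') (at (cmap c p))"
  proof -
    have "(local_form1 A c \<omega> e has_derivative
        frechet_derivative (local_form1 A c \<omega> e) (at (cmap c p))) (at (cmap c p))" for e
      using \<omega> cA by (intro smooth_on_has_derivative) (auto simp: one_form_def)
    then have "(h has_derivative
        (\<lambda>u. \<chi> i. frechet_derivative (local_form1 A c \<omega> (axis i 1)) (at (cmap c p)) u)) (at (cmap c p))"
      unfolding h_def by (intro has_derivative_vec_lambda)
    then show ?thesis
      by blast
  qed
  then show thesis
    using 1 that unfolding local_coeffs_def by blast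
qed

text \<open>This is the quotient rule, to be used for both \<open>\<lambda>\<close> and
  \<open>\<sigma>\<close>.\<close>

lemma local_coeffs_divide:
  assumes \<omega>: "local_coeffs \<omega> c p h h'" and c: "c \<in> charts_at A p"
    and F: "((F \<circ> cinv c) has_derivative F') (at (cmap c p))" "F p \<noteq> (0::real)"
  shows "local_coeffs (\<lambda>q v. - \<omega> q v / F q) c p (\<lambda>x. - (1 / F (cinv c x)) *\<^sub>R h x)
    (\<lambda>u. (F' u / (F p)\<^sup>2) *\<^sub>R h (cmap c p) - (1 / F p) *\<^sub>R h' u)"
  unfolding local_coeffs_def
proof
  note p = cinv_cmap[OF charts_atD[OF c]]
  \<comment> \<open>Where \<open>F\<close> vanishes both sides are 0 by the convention on division,
    so the identity holds wherever the one for \<open>\<omega>\<close> does.\<close>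
  show "\<forall>\<^sub>F x in nhds (cmap c p). \<forall>e. local_form1 A c (\<lambda>q v. - \<omega> q v / F q) e x =
      - (1 / F (cinv c x)) *\<^sub>R h x \<bullet> e"
    using \<omega> unfolding local_coeffs_def local_form1_def by (auto elim!: eventually_mono)
  have "((\<lambda>x. F (cinv c x)) has_derivative F') (at (cmap c p))"
    using F(1) by (simp add: o_def)
  moreover have "(h has_derivative h') (at (cmap c p))"
    using \<omega> by (simp add: local_coeffs_def)
  ultimately show "((\<lambda>x. - (1 / F (cinv c x)) *\<^sub>R h x) has_derivative
      (\<lambda>u. (F' u / (F p)\<^sup>2) *\<^sub>R h (cmap c p) - (1 / F p) *\<^sub>R h' u)) (at (cmap c p))"
    using F(2) by (auto intro!: derivative_eq_intros simp: p fun_eq_iff power2_eq_square divide_simps)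
qed

section \<open>Smooth maps, pushforward and pullback\<close>

lemma smooth_map_coordinates:
  assumes \<Phi>: "smooth_map A \<Phi>" and c: "c \<in> charts_at A p" and d: "d \<in> charts_at A (\<Phi> p)"
  shows "smooth_on (cmap c ` (cdom c \<inter> \<Phi> -` cdom d)) (cmap d \<circ> \<Phi> \<circ> cinv c)"
    and "open (cmap c ` (cdom c \<inter> \<Phi> -` cdom d))"
    and "cmap c p \<in> cmap c ` (cdom c \<inter> \<Phi> -` cdom d)"
    and "(cmap d \<circ> \<Phi> \<circ> cinv c) differentiable at (cmap c p)"
proof -
  note cA = charts_atD[OF c] and dA = charts_atD[OF d]
  show 1: "smooth_on (cmap c ` (cdom c \<inter> \<Phi> -` cdom d)) (cmap d \<circ> \<Phi> \<circ> cinv c)"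
    using \<Phi> cA dA by (simp add: smooth_map_def)
  have "open (\<Phi> -` cdom d)"
    using \<Phi> open_cdom[OF dA(1)] by (simp add: smooth_map_def open_vimage)
  then show "open (cmap c ` (cdom c \<inter> \<Phi> -` cdom d))"
    by (rule open_chart_image_Int[OF cA(1)])
  show 2: "cmap c p \<in> cmap c ` (cdom c \<inter> \<Phi> -` cdom d)"
    using cA dA by auto
  show "(cmap d \<circ> \<Phi> \<circ> cinv c) differentiable at (cmap c p)"
    using smooth_on_differentiable[OF 1 2] .
qed

text \<open>\<open>pushforward\<close> is defined with the chart chosen at \<open>p\<close>. A
  change of source chart is covered by \<open>frechet_derivative_change_chart\<close>, a change of
  target chart by the chain rule with the transition from \<open>d\<close> to
  \<open>e\<close>.\<close>

lemma pushforward_coordinates: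
  assumes \<Phi>: "smooth_map A \<Phi>" and c: "c \<in> charts_at A p" and d: "d \<in> charts_at A (\<Phi> p)"
    and v: "v \<in> tangent_space A p"
  shows "pushforward A \<Phi> p v =
    coord_vec A d (\<Phi> p) (frechet_derivative (cmap d \<circ> \<Phi> \<circ> cinv c) (at (cmap c p)) (v c))"
proof
  fix e
  let ?c = "chart_at A p"
  note c0 = chart_at_in[of p]
  show "pushforward A \<Phi> p v e = coord_vec A d (\<Phi> p)
      (frechet_derivative (cmap d \<circ> \<Phi> \<circ> cinv c) (at (cmap c p)) (v c)) e"
  proof (cases "e \<in> charts_at A (\<Phi> p)")
    case True
    have vc: "v c = frechet_derivative (cmap c \<circ> cinv ?c) (at (cmap ?c p)) (v ?c)"
      using v c c0 unfolding tangent_space_def by blast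
    have "frechet_derivative (cmap e \<circ> \<Phi> \<circ> cinv ?c) (at (cmap ?c p)) (v ?c) =
        frechet_derivative (cmap e \<circ> \<Phi> \<circ> cinv c) (at (cmap c p)) (v c)"
      using frechet_derivative_change_chart[OF c0 c, of "cmap e \<circ> \<Phi>"]
        smooth_map_coordinates(4)[OF \<Phi> c True] vc by simp
    also have "\<dots> = frechet_derivative (cmap e \<circ> cinv d) (at (cmap d (\<Phi> p)))
        (frechet_derivative (cmap d \<circ> \<Phi> \<circ> cinv c) (at (cmap c p)) (v c))"
    proof -
      let ?G = "cmap d \<circ> \<Phi> \<circ> cinv c" and ?T = "cmap e \<circ> cinv d"
      have G: "?G (cmap c p) = cmap d (\<Phi> p)"
        using charts_atD[OF c] by (simp add: cinv_cmap)
      have "(?T \<circ> ?G has_derivative frechet_derivative ?T (at (cmap d (\<Phi> p))) \<circ>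
          frechet_derivative ?G (at (cmap c p))) (at (cmap c p))"
        using diff_chain_at[of ?G _ "cmap c p" ?T] transition_has_derivative[OF d True]
          smooth_map_coordinates(4)[OF \<Phi> c d] unfolding G frechet_derivative_works by blast
      moreover have "(?T \<circ> ?G) x = (cmap e \<circ> \<Phi> \<circ> cinv c) x"
        if "x \<in> cmap c ` (cdom c \<inter> \<Phi> -` cdom d)" for x
        using that charts_atD[OF c] charts_atD[OF d] by (auto simp: cinv_cmap)
      ultimately have "((cmap e \<circ> \<Phi> \<circ> cinv c) has_derivative
          frechet_derivative ?T (at (cmap d (\<Phi> p))) \<circ>
          frechet_derivative ?G (at (cmap c p))) (at (cmap c p))"
        using has_derivative_transform_within_open[of "?T \<circ> ?G" _ "cmap c p" UNIV
            "cmap c ` (cdom c \<inter> \<Phi> -` cdom d)" "cmap e \<circ> \<Phi> \<circ> cinv c"]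
          smooth_map_coordinates(2,3)[OF \<Phi> c d] by blast
      from frechet_derivative_at[OF this] show ?thesis
        by (metis comp_apply)
    qed
    finally show ?thesis
      using True by (simp add: pushforward_def coord_vec_def Let_def)
  next
    case False
    then show ?thesis
      by (simp add: pushforward_def coord_vec_def Let_def)
  qed
qed

text \<open>The coefficient vector of the pullback is the transposed Jacobian of \<open>G\<close>
  applied to \<open>h \<circ> G\<close>. Its derivative contains second derivatives of
  \<open>G\<close>, which are symmetric and cancel in the skew part. \<open>\<Phi>\<close> may be
  singular here.\<close>

lemma local_coeffs_pullback:
  fixes \<Phi> :: "'a \<Rightarrow> 'a" and c d :: "('a, 'n) chart"
  defines "G \<equiv> cmap d \<circ> \<Phi> \<circ> cinv c"
  assumes \<Phi>: "smooth_map A \<Phi>" and c: "c \<in> charts_at A p" and d: "d \<in> charts_at A (\<Phi> p)"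
    and \<omega>: "local_coeffs \<omega> d (\<Phi> p) h h'"
  obtains a a' where "local_coeffs (pullback1 A \<Phi> \<omega>) c p a a'"
    and "\<And>u v. a' u \<bullet> v - a' v \<bullet> u =
      h' (frechet_derivative G (at (cmap c p)) u) \<bullet> frechet_derivative G (at (cmap c p)) v
      - h' (frechet_derivative G (at (cmap c p)) v) \<bullet> frechet_derivative G (at (cmap c p)) u"
proof -
  note cA = charts_atD[OF c] and dA = charts_atD[OF d]
  let ?S = "cmap c ` (cdom c \<inter> \<Phi> -` cdom d)" and ?x = "cmap c p"
  note S = smooth_map_coordinates[OF \<Phi> c d, folded G_def]
  define D where "D = (\<lambda>x. frechet_derivative G (at x))"
  define a where "a = (\<lambda>x. \<chi> i. h (G x) \<bullet> D x (axis i 1))"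
  have Gx: "G ?x = cmap d (\<Phi> p)"
    by (simp add: G_def cinv_cmap cA)
  have GD: "(G has_derivative D x) (at x)" if "x \<in> ?S" for x
    unfolding D_def by (rule smooth_on_has_derivative[OF S(1) that])
  have inner_a: "a x \<bullet> e = h (G x) \<bullet> D x e" if "x \<in> ?S" for x e
  proof -
    interpret linear "D x"
      using GD[OF that] by (rule has_derivative_linear)
    have "linear (\<lambda>e. h (G x) \<bullet> D x e)"
      by (rule linearI) (simp_all add: add scaleR inner_add_right)
    from linear_functional_inner[OF this, THEN fun_cong, of e] show ?thesis
      by (simp add: a_def)
  qed
  have evS: "\<forall>\<^sub>F x in nhds ?x. x \<in> ?S"
    using S(2,3) by (rule eventually_nhds_in_open)
  \<comment> \<open>The expression of \<open>\<omega>\<close> by \<open>h\<close> is valid only near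
    \<open>G ?x\<close>; continuity of \<open>G\<close> transfers it to points near
    \<open>?x\<close>.\<close>
  have "(G \<longlongrightarrow> G ?x) (nhds ?x)"
    using has_derivative_continuous[OF GD[OF S(3)]] by (simp add: continuous_within tendsto_at_iff_tendsto_nhds)
  then have "\<forall>\<^sub>F x in nhds ?x. \<forall>e. local_form1 A d \<omega> e (G x) = h (G x) \<bullet> e"
    using \<omega> unfolding local_coeffs_def Gx filterlim_iff by blast
  then have "\<forall>\<^sub>F x in nhds ?x. \<forall>e. local_form1 A c (pullback1 A \<Phi> \<omega>) e x = a x \<bullet> e"
    using evS
  proof eventually_elim
    case (elim x)
    then obtain q where q: "q \<in> cdom c" "\<Phi> q \<in> cdom d" "x = cmap c q"
      by auto
    have cq: "c \<in> charts_at A q" and dq: "d \<in> charts_at A (\<Phi> q)"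
      using q cA dA by (auto simp: charts_at_def)
    have [simp]: "cinv c x = q"
      using q cA by (simp add: cinv_cmap)
    have Gq: "cinv d (G x) = \<Phi> q"
      using q cA(1) dA(1) by (simp add: G_def cinv_cmap)
    show ?case
    proof
      fix e
      have "local_form1 A c (pullback1 A \<Phi> \<omega>) e x = \<omega> (\<Phi> q) (coord_vec A d (\<Phi> q) (D x e))"
        using pushforward_coordinates[OF \<Phi> cq dq coord_vec_in_tangent_space[OF cq]]
        by (simp add: local_form1_def pullback1_def coord_vec_self[OF cq] D_def G_def q(3)[symmetric])
      also have "\<dots> = h (G x) \<bullet> D x e"
        using elim(1) Gq by (simp add: local_form1_def)
      finally show "local_form1 A c (pullback1 A \<Phi> \<omega>) e x = a x \<bullet> e"
        using inner_a elim(2) by simp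
    qed
  qed
  moreover
  define a' where "a' = (\<lambda>u. \<chi> i. h' (D ?x u) \<bullet> D ?x (axis i 1)
      + h (G ?x) \<bullet> frechet_derivative (\<lambda>x. D x (axis i 1)) (at ?x) u)"
  have DD: "((\<lambda>x. D x e) has_derivative frechet_derivative (\<lambda>x. D x e) (at ?x)) (at ?x)" for e
    unfolding D_def
    by (rule smooth_on_has_derivative[OF smooth_on_frechet_derivative[OF S(1)] S(3)])
  have hG: "((\<lambda>x. h (G x)) has_derivative (\<lambda>u. h' (D ?x u))) (at ?x)"
    using has_derivative_compose[OF GD[OF S(3)], of h h'] \<omega> unfolding Gx local_coeffs_def by blast
  have "(a has_derivative a') (at ?x)"
    unfolding a_def a'_def
    by (intro has_derivative_vec_lambda) (rule has_derivative_eq_rhs[OF has_derivative_inner[OF hG DD]], auto)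
  moreover
  \<comment> \<open>\<open>a'\<close> is built from the basis vectors; uniqueness of the derivative
    yields the formula for every \<open>v\<close> without first proving the second derivative of
    \<open>G\<close> linear in \<open>v\<close>.\<close>
  have a'_inner: "a' u \<bullet> v = h' (D ?x u) \<bullet> D ?x v
      + h (G ?x) \<bullet> frechet_derivative (\<lambda>x. D x v) (at ?x) u" for u v
  proof -
    have "((\<lambda>x. a x \<bullet> v) has_derivative (\<lambda>u. a' u \<bullet> v)) (at ?x)"
      using \<open>(a has_derivative a') (at ?x)\<close> by (rule has_derivative_inner_left)
    moreover have "((\<lambda>x. h (G x) \<bullet> D x v) has_derivative (\<lambda>u. h' (D ?x u) \<bullet> D ?x v
      + h (G ?x) \<bullet> frechet_derivative (\<lambda>x. D x v) (at ?x) u)) (at ?x)"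
      by (rule has_derivative_eq_rhs[OF has_derivative_inner[OF hG DD]]) auto
    then have "((\<lambda>x. a x \<bullet> v) has_derivative (\<lambda>u. h' (D ?x u) \<bullet> D ?x v
      + h (G ?x) \<bullet> frechet_derivative (\<lambda>x. D x v) (at ?x) u)) (at ?x)"
      by (rule has_derivative_transform_within_open[OF _ S(2,3)]) (simp add: inner_a)
    ultimately show ?thesis
      by (rule has_derivative_unique[THEN fun_cong])
  qed
  have "a' u \<bullet> v - a' v \<bullet> u = h' (D ?x u) \<bullet> D ?x v - h' (D ?x v) \<bullet> D ?x u" for u v
    using smooth_on_second_derivative_symmetric[OF S(1-3), of u v] by (simp add: a'_inner D_def)
  ultimately show thesis
    using that[of a a'] unfolding local_coeffs_def D_def by blast
qed

text \<open>In the charts chosen at \<open>p\<close> and \<open>\<Phi> p\<close> both sides are skew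
  parts of Jacobians, which \<open>local_coeffs_pullback\<close> compares.\<close>

lemma ext_d_pullback1:
  assumes \<Phi>: "smooth_map A \<Phi>" and \<omega>: "one_form A \<omega>"
    and v: "v \<in> tangent_space A p" "w \<in> tangent_space A p"
  shows "ext_d A (pullback1 A \<Phi> \<omega>) p v w =
    ext_d A \<omega> (\<Phi> p) (pushforward A \<Phi> p v) (pushforward A \<Phi> p w)"
proof -
  note c = chart_at_in[of p] and d = chart_at_in[of "\<Phi> p"]
  obtain h h' where h: "local_coeffs \<omega> (chart_at A (\<Phi> p)) (\<Phi> p) h h'"
    using one_form_local_coeffs[OF \<omega> d] .
  obtain a a' where a: "local_coeffs (pullback1 A \<Phi> \<omega>) (chart_at A p) p a a'"
    "\<And>u v. a' u \<bullet> v - a' v \<bullet> u =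
      h' (frechet_derivative (cmap (chart_at A (\<Phi> p)) \<circ> \<Phi> \<circ> cinv (chart_at A p)) (at (cmap (chart_at A p) p)) u)
        \<bullet> frechet_derivative (cmap (chart_at A (\<Phi> p)) \<circ> \<Phi> \<circ> cinv (chart_at A p)) (at (cmap (chart_at A p) p)) v
      - h' (frechet_derivative (cmap (chart_at A (\<Phi> p)) \<circ> \<Phi> \<circ> cinv (chart_at A p)) (at (cmap (chart_at A p) p)) v)
        \<bullet> frechet_derivative (cmap (chart_at A (\<Phi> p)) \<circ> \<Phi> \<circ> cinv (chart_at A p)) (at (cmap (chart_at A p) p)) u"
    using local_coeffs_pullback[OF \<Phi> c d h] by blast
  show ?thesis
    by (simp add: ext_d_local_coeffs[OF a(1)] ext_d_local_coeffs[OF h] a(2) coord_vec_self[OF d]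
        pushforward_coordinates[OF \<Phi> c d v(1)] pushforward_coordinates[OF \<Phi> c d v(2)])
qed

text \<open>This turns the assumption on the pullback of \<open>\<mu>\<close> into one on the wedge
  of \<open>\<alpha>\<close> with \<open>d\<alpha>\<close>.\<close>

lemma pullback3_wedge12:
  assumes "smooth_map A \<Phi>" "one_form A \<omega>"
    and "u \<in> tangent_space A p" "v \<in> tangent_space A p" "w \<in> tangent_space A p"
  shows "pullback3 A \<Phi> (wedge12 \<omega> (ext_d A \<omega>)) p u v w =
    wedge12 (pullback1 A \<Phi> \<omega>) (ext_d A (pullback1 A \<Phi> \<omega>)) p u v w"
  using assms by (simp add: pullback3_def wedge12_def ext_d_pullback1 pullback1_def)

end


section \<open>Linear algebra in dimension three\<close>

lemma real3_expansion:
  "u = (u $ 1) *\<^sub>R axis 1 1 + (u $ 2) *\<^sub>R axis 2 1 + (u $ 3) *\<^sub>R axis 3 (1::real)" for u :: "real^3"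
  using basis_expansion[of u] by (simp add: scalar_mult_eq_scaleR sum_3)

text \<open>The skew part of a 3 by 3 matrix has three free entries, which are the components of
  \<open>b\<close>; if \<open>f\<close> is the Jacobian of a coefficient vector, \<open>b\<close> is
  its curl.\<close>

lemma alternating_eq_cross3:
  assumes "linear (f :: real^3 \<Rightarrow> real^3)"
  obtains b where "\<And>u v. f u \<bullet> v - f v \<bullet> u = b \<bullet> cross3 u v"
proof
  fix u v
  interpret linear f by fact
  have f: "f w = w $ 1 *\<^sub>R f (axis 1 1) + w $ 2 *\<^sub>R f (axis 2 1) + w $ 3 *\<^sub>R f (axis 3 1)" for w
    by (subst real3_expansion[of w]) (simp only: add scaleR)
  show "f u \<bullet> v - f v \<bullet> u = vector [f (axis 2 1) $ 3 - f (axis 3 1) $ 2,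
      f (axis 3 1) $ 1 - f (axis 1 1) $ 3, f (axis 1 1) $ 2 - f (axis 2 1) $ 1] \<bullet> cross3 u v"
    unfolding f[of u] f[of v] by (simp add: cross3_simps)
qed

text \<open>In terms of \<open>cross3\<close>, \<open>wedge12\<close> of the forms with vectors \<open>h\<close> and \<open>b\<close> is \<open>h \<bullet> b\<close> times the
  determinant.\<close>

lemma cyclic_inner_cross3:
  "h \<bullet> u * (b \<bullet> cross3 v w) + h \<bullet> v * (b \<bullet> cross3 w u) + h \<bullet> w * (b \<bullet> cross3 u v) =
    (h \<bullet> b) * (u \<bullet> cross3 v w)"
  by (simp add: cross3_simps)

text \<open>The kernel of the 2-form with vector \<open>b\<close> is the line through
  \<open>b\<close>, on which \<open>h\<close> does not vanish. Lagrange's identity for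
  \<open>cross3 h (cross3 b w)\<close> makes this explicit.\<close>

lemma cross3_kernel:
  assumes "h \<bullet> b \<noteq> 0" "h \<bullet> w = 0" "\<And>z. b \<bullet> cross3 w z = 0"
  shows "w = 0"
proof -
  have "cross3 b w \<bullet> z = 0" for z
    using assms(3)[of z] cross_triple[of b w z] cross_triple[of w z b] by (simp add: inner_commute)
  then have "cross3 b w = 0"
    using inner_eq_zero_iff by blast
  then have "(h \<bullet> w) *\<^sub>R b - (h \<bullet> b) *\<^sub>R w = 0"
    by (metis Lagrange cross_zero_right)
  then show ?thesis
    using assms(1,2) by simp
qed

text \<open>The 2-form with vector \<open>m\<close> kills \<open>X\<close>, so \<open>m\<close> is
  parallel to \<open>X\<close>; pairing with \<open>l\<close> gives the factor, which is the density
  of the wedge of the forms of \<open>l\<close> and \<open>m\<close>.\<close>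

lemma cross3_parallel:
  assumes "l \<bullet> X = 1" "\<And>z. m \<bullet> cross3 X z = 0"
  shows "m = (l \<bullet> m) *\<^sub>R X"
proof -
  have "cross3 m X \<bullet> z = 0" for z
    using assms(2)[of z] cross_triple[of m X z] cross_triple[of X z m] by (simp add: inner_commute)
  then have "cross3 m X = 0"
    using inner_eq_zero_iff by blast
  then have "(l \<bullet> X) *\<^sub>R m - (l \<bullet> m) *\<^sub>R X = 0"
    by (metis Lagrange cross_zero_right)
  then show ?thesis
    using assms(1) by simp
qed

text \<open>The vector of \<open>d(- \<omega>/F)\<close> if \<open>h\<close>, \<open>b\<close> and \<open>g\<close> are those of \<open>\<omega>\<close>, \<open>d\<omega>\<close> and \<open>dF\<close>.\<close>

definition quot_curl :: "real^3 \<Rightarrow> real^3 \<Rightarrow> real \<Rightarrow> real^3 \<Rightarrow> real^3" where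
  "quot_curl h b F g = (1 / F\<^sup>2) *\<^sub>R cross3 g h - (1 / F) *\<^sub>R b"

text \<open>For \<open>\<theta> = -\<omega>/F\<close> this computes the density of the wedge of
  \<open>\<theta>\<close> with \<open>d\<theta>\<close>. The term with \<open>dF\<close> drops out
  because it contains \<open>\<omega>\<close> twice.\<close>

lemma inner_quot_curl:
  assumes "F \<noteq> 0"
  shows "(- (1 / F) *\<^sub>R h) \<bullet> quot_curl h b F g = (h \<bullet> b) / F\<^sup>2"
proof -
  have "h \<bullet> cross3 g h = 0"
    by (rule dot_cross_self)
  then show ?thesis
    by (simp add: quot_curl_def inner_diff_right power2_eq_square)
qed

text \<open>If \<open>\<omega>(X) = -F\<close> and \<open>\<iota>\<^sub>X d\<omega>\<close> is \<open>dF\<close> up to a multiple of \<open>\<omega>\<close>, then \<open>X\<close> is the Reeb vector of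
  \<open>- \<omega>/F\<close>. This covers both \<open>\<lambda>\<close> (by definition of \<open>X\<close>) and \<open>\<sigma>\<close> (by the canonoid condition).\<close>

lemma quot_curl_kernel:
  assumes "h \<bullet> X = - F" "\<And>z. b \<bullet> cross3 X z = g \<bullet> z - r * (h \<bullet> z)" "F \<noteq> 0"
  shows "quot_curl h b F g \<bullet> cross3 X z = 0"
proof -
  \<comment> \<open>With \<open>z = X\<close> the cross product vanishes, which fixes the value of
    \<open>dF\<close> on \<open>X\<close>.\<close>
  have "g \<bullet> X = - r * F"
    using assms(2)[of X] assms(1) by simp
  then have "cross3 g h \<bullet> cross3 X z = - r * F * (h \<bullet> z) + F * (g \<bullet> z)"
    by (simp add: dot_cross assms(1))
  then show ?thesis
    using assms(3) by (simp add: quot_curl_def inner_diff_left assms(2) power2_eq_square field_simps)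
qed

text \<open>Both vectors are multiples of the common Reeb vector \<open>X\<close>.\<close>

lemma proportional_curls:
  assumes "l \<bullet> X = 1" "\<And>z. m \<bullet> cross3 X z = 0"
    and "s \<bullet> X = 1" "\<And>z. t \<bullet> cross3 X z = 0"
    and "s \<bullet> t = \<kappa> * (l \<bullet> m)"
  shows "t = \<kappa> *\<^sub>R m"
  using cross3_parallel[OF assms(1,2)] cross3_parallel[OF assms(3,4)] assms(5)
  by (metis scaleR_scaleR)


section \<open>Canonoid maps in dimension three\<close>

context smooth_manifold
begin

lemma vector_field_has_derivative:
  assumes "vector_field A X" "c \<in> charts_at A p"
  shows "((\<lambda>x. X (cinv c x) c) has_derivative
    frechet_derivative (\<lambda>x. X (cinv c x) c) (at (cmap c p))) (at (cmap c p))"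
  using assms charts_atD[OF assms(2)]
  by (intro smooth_on_has_derivative) (auto simp: vector_field_def)

lemma smooth_function_has_derivative:
  assumes "smooth_function A f" "c \<in> charts_at A p"
  shows "((f \<circ> cinv c) has_derivative frechet_derivative (f \<circ> cinv c) (at (cmap c p))) (at (cmap c p))"
  using assms charts_atD[OF assms(2)]
  by (intro smooth_on_has_derivative) (auto simp: smooth_function_def)

text \<open>Cartan's formula \<open>L\<^sub>X \<omega> = \<iota>\<^sub>X d\<omega> + d(\<omega>(X))\<close>.\<close>

lemma lie_derivative_Cartan:
  fixes p :: 'a
  defines "c \<equiv> chart_at A p"
  assumes \<omega>: "local_coeffs \<omega> c p a a'" and X: "vector_field A X"
  obtains K' where "(((\<lambda>q. - \<omega> q (X q)) \<circ> cinv c) has_derivative K') (at (cmap c p))"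
    and "\<And>v. v \<in> tangent_space A p \<Longrightarrow>
      lie_derivative A X \<omega> p v = a' (X p c) \<bullet> v c - a' (v c) \<bullet> X p c - K' (v c)"
proof
  let ?x = "cmap c p"
  have c: "c \<in> charts_at A p"
    unfolding c_def by (rule chart_at_in)
  have p: "cinv c ?x = p"
    using charts_atD[OF c] by (simp add: cinv_cmap)
  define X' where "X' = frechet_derivative (\<lambda>x. X (cinv c x) c) (at ?x)"
  have X': "((\<lambda>x. X (cinv c x) c) has_derivative X') (at ?x)"
    unfolding X'_def by (rule vector_field_has_derivative[OF X c])
  have a': "(a has_derivative a') (at ?x)"
    using \<omega> by (simp add: local_coeffs_def)
  \<comment> \<open>The product rule for \<open>- \<omega>(X)\<close>, with the sign of
    \<open>K = - \<alpha>(X)\<close>. The term with \<open>X'\<close> is the one that the bracket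
    contributes to the Lie derivative, so the two cancel at the end.\<close>
  have "((\<lambda>x. - (a x \<bullet> X (cinv c x) c)) has_derivative (\<lambda>u. - (a ?x \<bullet> X' u + a' u \<bullet> X p c))) (at ?x)"
    using has_derivative_minus[OF has_derivative_inner[OF a' X']] by (simp add: p)
  moreover have "\<forall>\<^sub>F x in nhds ?x. (\<forall>e. local_form1 A c \<omega> e x = a x \<bullet> e) \<and> x \<in> cmap c ` cdom c"
    using \<omega> eventually_in_chart[OF c] by (simp add: local_coeffs_def eventually_conj)
  then obtain S where S: "open S" "?x \<in> S" and
    S': "\<And>x. x \<in> S \<Longrightarrow> (\<forall>e. local_form1 A c \<omega> e x = a x \<bullet> e) \<and> x \<in> cmap c ` cdom c"
    unfolding eventually_nhds by blast
  have "- (a x \<bullet> X (cinv c x) c) = ((\<lambda>q. - \<omega> q (X q)) \<circ> cinv c) x" if "x \<in> S" for x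
  proof -
    have "X (cinv c x) \<in> tangent_space A (cinv c x)"
      using X by (simp add: vector_field_def)
    then show ?thesis
      using S'[OF that] coord_vec_component[OF _ cinv_charts_at[OF charts_atD(1)[OF c]]]
      unfolding local_form1_def comp_def by metis
  qed
  ultimately show "(((\<lambda>q. - \<omega> q (X q)) \<circ> cinv c) has_derivative
      (\<lambda>u. - (a ?x \<bullet> X' u + a' u \<bullet> X p c))) (at ?x)"
    using has_derivative_transform_within_open S by blast
  fix v
  assume "v \<in> tangent_space A p"
  have "frechet_derivative (local_form1 A c \<omega> (v c)) (at ?x) = (\<lambda>u. a' u \<bullet> v c)"
    by (rule frechet_derivative_at[OF local_coeffs_has_derivative[OF \<omega>], symmetric])
  moreover have "\<omega> p (coord_vec A c p (X' (v c))) = a ?x \<bullet> X' (v c)"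
    using local_coeffs_value[OF \<omega> c coord_vec_in_tangent_space[OF c]] by (simp add: coord_vec_self[OF c])
  ultimately show "lie_derivative A X \<omega> p v =
      a' (X p c) \<bullet> v c - a' (v c) \<bullet> X p c - - (a ?x \<bullet> X' (v c) + a' (v c) \<bullet> X p c)"
    unfolding lie_derivative_def c_def[symmetric] Let_def X'_def[symmetric] by simp
qed

end

section \<open>Contact forms as vectors, and uniqueness of their Reeb and Hamiltonian fields\<close>

locale smooth_manifold3 = smooth_manifold A for A :: "('a::topological_space, 3) chart set"
begin

text \<open>In the chart chosen at \<open>p\<close>, the forms \<open>\<omega>\<close> and \<open>d\<omega>\<close> at \<open>p\<close> are \<open>h \<bullet> v\<close> and \<open>b \<bullet> cross3 v w\<close>,
  so that \<open>b\<close> is the curl of the coefficient vector of \<open>\<omega>\<close>.\<close>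

definition jet :: "('a, 3) form1 \<Rightarrow> 'a \<Rightarrow> real^3 \<Rightarrow> real^3 \<Rightarrow> bool" where
  "jet \<omega> p h b \<longleftrightarrow>
    (\<forall>v\<in>tangent_space A p. \<omega> p v = h \<bullet> v (chart_at A p)) \<and>
    (\<forall>v\<in>tangent_space A p. \<forall>w\<in>tangent_space A p.
      ext_d A \<omega> p v w = b \<bullet> cross3 (v (chart_at A p)) (w (chart_at A p)))"

lemma jet_value: "jet \<omega> p h b \<Longrightarrow> v \<in> tangent_space A p \<Longrightarrow> \<omega> p v = h \<bullet> v (chart_at A p)"
  by (simp add: jet_def)

lemma jet_ext_d:
  "jet \<omega> p h b \<Longrightarrow> v \<in> tangent_space A p \<Longrightarrow> w \<in> tangent_space A p \<Longrightarrow>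
    ext_d A \<omega> p v w = b \<bullet> cross3 (v (chart_at A p)) (w (chart_at A p))"
  by (simp add: jet_def)

text \<open>A \<open>jet\<close> records values at \<open>p\<close> only; the second conclusion
  keeps the link to the Jacobian that \<open>jet_divide\<close> needs.\<close>

lemma local_coeffs_jet:
  assumes "local_coeffs \<omega> (chart_at A p) p h h'"
  obtains b where "jet \<omega> p (h (cmap (chart_at A p) p)) b"
    and "\<And>u v. h' u \<bullet> v - h' v \<bullet> u = b \<bullet> cross3 u v"
proof -
  have "linear h'"
    using assms unfolding local_coeffs_def by (blast intro: has_derivative_linear)
  then obtain b where "\<And>u v. h' u \<bullet> v - h' v \<bullet> u = b \<bullet> cross3 u v"
    using alternating_eq_cross3 by blast
  then show thesis
    using that[of b] local_coeffs_value[OF assms chart_at_in] ext_d_local_coeffs[OF assms]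
    unfolding jet_def by simp
qed

text \<open>The skew part of the quotient rule: the wedge of \<open>dF\<close> and
  \<open>\<omega>\<close> has the vector \<open>cross3 g h\<close> by
  \<open>dot_cross\<close>.\<close>

lemma jet_divide:
  assumes \<omega>: "local_coeffs \<omega> (chart_at A p) p h h'"
    and b: "\<And>u v. h' u \<bullet> v - h' v \<bullet> u = b \<bullet> cross3 u v"
    and F: "((F \<circ> cinv (chart_at A p)) has_derivative (\<lambda>u. g \<bullet> u)) (at (cmap (chart_at A p) p))"
      "F p \<noteq> 0"
  shows "jet (\<lambda>q v. - \<omega> q v / F q) p (- (1 / F p) *\<^sub>R h (cmap (chart_at A p) p))
    (quot_curl (h (cmap (chart_at A p) p)) b (F p) g)"
proof -
  let ?h = "h (cmap (chart_at A p) p)"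
  note L = local_coeffs_divide[OF \<omega> chart_at_in F]
  have "((g \<bullet> u / (F p)\<^sup>2) *\<^sub>R ?h - (1 / F p) *\<^sub>R h' u) \<bullet> v -
      ((g \<bullet> v / (F p)\<^sup>2) *\<^sub>R ?h - (1 / F p) *\<^sub>R h' v) \<bullet> u = quot_curl ?h b (F p) g \<bullet> cross3 u v" for u v
  proof -
    have "((g \<bullet> u / (F p)\<^sup>2) *\<^sub>R ?h - (1 / F p) *\<^sub>R h' u) \<bullet> v -
      ((g \<bullet> v / (F p)\<^sup>2) *\<^sub>R ?h - (1 / F p) *\<^sub>R h' v) \<bullet> u
      = (1 / (F p)\<^sup>2) * ((g \<bullet> u) * (?h \<bullet> v) - (g \<bullet> v) * (?h \<bullet> u)) - (1 / F p) * (h' u \<bullet> v - h' v \<bullet> u)"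
      by (simp add: inner_diff_left algebra_simps add_divide_distrib diff_divide_distrib)
    then show ?thesis
      by (simp add: b quot_curl_def inner_diff_left dot_cross)
  qed
  then show ?thesis
    unfolding jet_def
    using local_coeffs_value[OF L chart_at_in] ext_d_local_coeffs[OF L]
    by (simp add: cinv_cmap charts_atD[OF chart_at_in])
qed

lemma wedge12_jet:
  assumes "jet \<omega> p h b" "u \<in> tangent_space A p" "v \<in> tangent_space A p" "w \<in> tangent_space A p"
  shows "wedge12 \<omega> (ext_d A \<omega>) p u v w =
    (h \<bullet> b) * (u (chart_at A p) \<bullet> cross3 (v (chart_at A p)) (w (chart_at A p)))"
  using assms(2-) cyclic_inner_cross3[of h _ b]
  by (simp add: wedge12_def jet_value[OF assms(1)] jet_ext_d[OF assms(1)])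

lemma contact_jet_nonzero:
  assumes "contact_form A \<eta>" "jet \<eta> p h b"
  shows "h \<bullet> b \<noteq> 0"
  using assms(1) wedge12_jet[OF assms(2)] unfolding contact_form_def by (metis mult_zero_left)

text \<open>The difference of the two vectors is killed by \<open>\<omega>\<close> and by
  \<open>d\<omega>\<close>, so \<open>cross3_kernel\<close> applies. This gives uniqueness of the
  Reeb field, of the Hamiltonian field and of \<open>N\<close>.\<close>

lemma jet_determines_vector:
  assumes j: "jet \<omega> p h b" "h \<bullet> b \<noteq> 0" and v: "v \<in> tangent_space A p" "w \<in> tangent_space A p"
    and "\<omega> p v = \<omega> p w" "\<And>z. z \<in> tangent_space A p \<Longrightarrow> ext_d A \<omega> p v z = ext_d A \<omega> p w z"
  shows "v = w"
proof (rule tangent_vector_eqI[OF v chart_at_in])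
  let ?c = "chart_at A p"
  have "v ?c - w ?c = 0"
  proof (rule cross3_kernel[OF j(2)])
    show "h \<bullet> (v ?c - w ?c) = 0"
      using assms(5) v by (simp add: jet_value[OF j(1)] inner_diff_right)
    fix z
    have "coord_vec A ?c p z \<in> tangent_space A p"
      by (rule coord_vec_in_tangent_space[OF chart_at_in])
    from assms(6)[OF this] have "b \<bullet> cross3 (v ?c) z = b \<bullet> cross3 (w ?c) z"
      using v coord_vec_in_tangent_space[OF chart_at_in]
      by (simp add: jet_ext_d[OF j(1)] coord_vec_self[OF chart_at_in])
    then show "b \<bullet> cross3 (v ?c - w ?c) z = 0"
      by (simp add: Cross3.left_diff_distrib inner_diff_right)
  qed
  then show "v ?c = w ?c"
    by simp
qed

lemma contact_determines_vector:
  assumes "contact_form A \<eta>" "v \<in> tangent_space A p" "w \<in> tangent_space A p"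
    and "\<eta> p v = \<eta> p w" "\<And>z. z \<in> tangent_space A p \<Longrightarrow> ext_d A \<eta> p v z = ext_d A \<eta> p w z"
  shows "v = w"
proof -
  obtain h h' where "local_coeffs \<eta> (chart_at A p) p h h'"
    using assms(1) one_form_local_coeffs[OF _ chart_at_in] unfolding contact_form_def by blast
  then obtain b where "jet \<eta> p (h (cmap (chart_at A p) p)) b"
    using local_coeffs_jet by blast
  then show ?thesis
    using jet_determines_vector contact_jet_nonzero assms by blast
qed

lemma reeb_field_unique:
  assumes "contact_form A \<eta>" "reeb_field A \<eta> R" "reeb_field A \<eta> R'"
  shows "R = R'"
proof
  fix p
  show "R p = R' p"
    by (rule contact_determines_vector[OF assms(1)])
      (use assms(2,3) in \<open>auto simp: reeb_field_def vector_field_def\<close>)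
qed

text \<open>Each field comes with its own existentially quantified Reeb field, so these are
  identified first.\<close>

lemma contact_hamiltonian_field_unique:
  assumes \<eta>: "contact_form A \<eta>"
    and X: "contact_hamiltonian_field A \<eta> H X" and Y: "contact_hamiltonian_field A \<eta> H Y"
  shows "X = Y"
proof
  fix p
  obtain R where R: "reeb_field A \<eta> R" "\<And>p. \<eta> p (X p) = - H p"
    "\<And>p w. w \<in> tangent_space A p \<Longrightarrow>
      ext_d A \<eta> p (X p) w = differential A H p w - differential A H p (R p) * \<eta> p w"
    using X unfolding contact_hamiltonian_field_def by blast
  obtain S where S: "reeb_field A \<eta> S" "\<And>p. \<eta> p (Y p) = - H p"
    "\<And>p w. w \<in> tangent_space A p \<Longrightarrow>
      ext_d A \<eta> p (Y p) w = differential A H p w - differential A H p (S p) * \<eta> p w"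
    using Y unfolding contact_hamiltonian_field_def by blast
  have "S = R"
    by (rule reeb_field_unique[OF \<eta> S(1) R(1)])
  show "X p = Y p"
    by (rule contact_determines_vector[OF \<eta>])
      (use X Y in \<open>auto simp: contact_hamiltonian_field_def vector_field_def R S \<open>S = R\<close>\<close>)
qed

end

section \<open>The invariant endomorphism of a canonoid map, its powers and its traces\<close>

locale canonoid_system = smooth_manifold3 A
  for A :: "('a::topological_space, 3) chart set" +
  fixes \<eta> \<alpha> lam \<sigma> :: "('a, 3) form1"
    and H K \<rho> \<kappa> :: "'a \<Rightarrow> real"
    and X :: "'a \<Rightarrow> ('a, 3) tvec"
    and \<Phi> :: "'a \<Rightarrow> 'a"
    and U :: "'a set"
    and P N :: "'a \<Rightarrow> ('a, 3) tvec \<Rightarrow> ('a, 3) tvec"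
  assumes contact: "contact_form A \<eta>"
    and smooth_H: "smooth_function A H"
    and canonoid: "contact_canonoid A \<eta> H \<Phi>"
    and field: "contact_hamiltonian_field A \<eta> H X"
    and \<alpha>_eq: "\<alpha> = pullback1 A \<Phi> \<eta>"
    and K_eq: "K = (\<lambda>p. - \<alpha> p (X p))"
    and volume: "\<And>p u v w. u \<in> tangent_space A p \<Longrightarrow> v \<in> tangent_space A p \<Longrightarrow> w \<in> tangent_space A p \<Longrightarrow>
      pullback3 A \<Phi> (wedge12 \<eta> (ext_d A \<eta>)) p u v w = \<rho> p * wedge12 \<eta> (ext_d A \<eta>) p u v w"
    and U_eq: "U = {p. H p * K p \<noteq> 0}"
    and lam_eq: "lam = (\<lambda>p v. - \<eta> p v / H p)"
    and \<sigma>_eq: "\<sigma> = (\<lambda>p v. - \<alpha> p v / K p)"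
    and P_eq: "P = (\<lambda>p v. tcomb 1 v (- lam p v) (X p))"
    and \<kappa>_eq: "\<kappa> = (\<lambda>p. \<rho> p * (H p / K p)\<^sup>2)"
    and endo: "invariant_endo A U lam \<sigma> N"
begin

lemma one_form_\<eta>: "one_form A \<eta>"
  using contact by (simp add: contact_form_def)

lemma smooth_\<Phi>: "smooth_map A \<Phi>"
  using canonoid by (simp add: contact_canonoid_def)

lemma vector_field_X: "vector_field A X"
  using field by (simp add: contact_hamiltonian_field_def)

lemma X_in_tangent_space: "X p \<in> tangent_space A p"
  using vector_field_X by (simp add: vector_field_def)

lemma \<eta>_X: "\<eta> p (X p) = - H p"
  using field by (auto simp: contact_hamiltonian_field_def)

lemma lam_X: "H p \<noteq> 0 \<Longrightarrow> lam p (X p) = 1"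
  by (simp add: lam_eq \<eta>_X)

lemma lam_tcomb:
  assumes "v \<in> tangent_space A p" "w \<in> tangent_space A p"
  shows "lam p (tcomb a v b w) = a * lam p v + b * lam p w"
proof -
  have "\<eta> p (tcomb a v b w) = a * \<eta> p v + b * \<eta> p w"
    using one_form_\<eta> assms by (simp add: one_form_def)
  then show ?thesis
    by (simp add: lam_eq add_divide_distrib)
qed

lemma P_in_tangent_space: "v \<in> tangent_space A p \<Longrightarrow> P p v \<in> tangent_space A p"
  by (simp add: P_eq tcomb_in_tangent_space X_in_tangent_space)

lemma lam_P:
  assumes "H p \<noteq> 0" "v \<in> tangent_space A p"
  shows "lam p (P p v) = 0"
  using assms by (simp add: P_eq lam_tcomb X_in_tangent_space lam_X)

text \<open>\<open>contact_canonoid\<close> quantifies over its own Hamiltonian field, which is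
  \<open>X\<close> by uniqueness.\<close>

lemma lie_derivative_\<alpha>:
  "\<exists>b. \<forall>p. \<forall>v\<in>tangent_space A p. lie_derivative A X \<alpha> p v = - b p * \<alpha> p v"
proof -
  obtain Y b where "contact_hamiltonian_field A \<eta> H Y"
    "\<forall>p. \<forall>v\<in>tangent_space A p. lie_derivative A Y \<alpha> p v = - b p * \<alpha> p v"
    using canonoid unfolding contact_canonoid_def \<alpha>_eq by blast
  moreover from this have "X = Y"
    using contact_hamiltonian_field_unique[OF contact field] by blast
  ultimately show ?thesis
    by blast
qed

lemma \<alpha>_local_coeffs:
  obtains a a' where "local_coeffs \<alpha> (chart_at A p) p a a'"
proof -
  obtain h h' where "local_coeffs \<eta> (chart_at A (\<Phi> p)) (\<Phi> p) h h'"
    using one_form_local_coeffs[OF one_form_\<eta> chart_at_in] .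
  then show thesis
  proof (rule local_coeffs_pullback[OF smooth_\<Phi> chart_at_in chart_at_in])
    fix a a'
    assume "local_coeffs (pullback1 A \<Phi> \<eta>) (chart_at A p) p a a'"
    then show thesis
      by (rule that[unfolded \<alpha>_eq])
  qed
qed

text \<open>Cartan's formula already produces this derivative, as \<open>K\<close> is
  \<open>- \<alpha>(X)\<close>.\<close>

lemma K_has_derivative:
  obtains K' where "((K \<circ> cinv (chart_at A p)) has_derivative K') (at (cmap (chart_at A p) p))"
proof -
  obtain a a' where "local_coeffs \<alpha> (chart_at A p) p a a'"
    by (rule \<alpha>_local_coeffs)
  from lie_derivative_Cartan[OF this vector_field_X] that show thesis
    unfolding K_eq by blast
qed

text \<open>Using one vector \<open>m\<close> in both jets encodes
  \<open>d\<sigma> = \<kappa> d\<lambda>\<close> at \<open>p\<close>; the other two facts say that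
  \<open>\<lambda>\<close> is contact there and that \<open>X\<close> lies in the kernel of
  \<open>d\<lambda>\<close>.\<close>

lemma jets:
  assumes "p \<in> U"
  obtains l m s where "jet lam p l m" "jet \<sigma> p s (\<kappa> p *\<^sub>R m)" "l \<bullet> m \<noteq> 0"
    "\<And>z. m \<bullet> cross3 (X p (chart_at A p)) z = 0"
proof -
  let ?c = "chart_at A p"
  let ?x = "cmap ?c p" and ?X = "X p ?c"
  note c = chart_at_in[of p]
  note TX = X_in_tangent_space[of p]
  note coord = coord_vec_in_tangent_space[OF c] and self = coord_vec_self[OF c]
  have HK: "H p \<noteq> 0" "K p \<noteq> 0"
    using assms U_eq by auto
  obtain h h' where h: "local_coeffs \<eta> ?c p h h'"
    using one_form_local_coeffs[OF one_form_\<eta> c] .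
  obtain b where b: "jet \<eta> p (h ?x) b" "\<And>u v. h' u \<bullet> v - h' v \<bullet> u = b \<bullet> cross3 u v"
    using local_coeffs_jet[OF h] by blast
  obtain a a' where a: "local_coeffs \<alpha> ?c p a a'"
    by (rule \<alpha>_local_coeffs)
  obtain d where d: "jet \<alpha> p (a ?x) d" "\<And>u v. a' u \<bullet> v - a' v \<bullet> u = d \<bullet> cross3 u v"
    using local_coeffs_jet[OF a] by blast
  obtain g where g: "frechet_derivative (H \<circ> cinv ?c) (at ?x) = (\<lambda>u. g \<bullet> u)"
    using linear_functional_inner[OF has_derivative_linear[OF
          smooth_function_has_derivative[OF smooth_H c]]] by (rule that)
  have H': "((H \<circ> cinv ?c) has_derivative (\<lambda>u. g \<bullet> u)) (at ?x)"
    using smooth_function_has_derivative[OF smooth_H c] by (simp only: g)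
  obtain K' where K': "((K \<circ> cinv ?c) has_derivative K') (at ?x)"
    and lie: "\<And>v. v \<in> tangent_space A p \<Longrightarrow>
      lie_derivative A X \<alpha> p v = a' ?X \<bullet> v ?c - a' (v ?c) \<bullet> ?X - K' (v ?c)"
    unfolding K_eq using lie_derivative_Cartan[OF a vector_field_X] by blast
  obtain k where k: "K' = (\<lambda>u. k \<bullet> u)"
    using linear_functional_inner[OF has_derivative_linear[OF K']] by (rule that)
  obtain R where R: "\<And>w. w \<in> tangent_space A p \<Longrightarrow>
      ext_d A \<eta> p (X p) w = differential A H p w - differential A H p (R p) * \<eta> p w"
    using field unfolding contact_hamiltonian_field_def by blast
  obtain \<beta> where "\<forall>p. \<forall>v\<in>tangent_space A p. lie_derivative A X \<alpha> p v = - \<beta> p * \<alpha> p v"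
    using lie_derivative_\<alpha> by (rule exE)
  then have \<beta>: "\<And>v. v \<in> tangent_space A p \<Longrightarrow> lie_derivative A X \<alpha> p v = - \<beta> p * \<alpha> p v"
    by (elim allE ballE) auto

  define m where "m = quot_curl (h ?x) b (H p) g"
  define t where "t = quot_curl (a ?x) d (K p) k"
  have hX: "h ?x \<bullet> ?X = - H p"
    using jet_value[OF b(1) TX] \<eta>_X by simp
  have aX: "a ?x \<bullet> ?X = - K p"
    using jet_value[OF d(1) TX] by (simp add: K_eq)
  \<comment> \<open>The multiplier \<open>r\<close> of \<open>quot_curl_kernel\<close> is
    \<open>R(H)\<close> here.\<close>
  have mX: "m \<bullet> cross3 ?X z = 0" for z
    unfolding m_def
  proof (rule quot_curl_kernel[OF hX _ HK(1)])
    fix z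
    show "b \<bullet> cross3 ?X z = g \<bullet> z - differential A H p (R p) * (h ?x \<bullet> z)"
      using R[OF coord[of z]] jet_ext_d[OF b(1) TX coord[of z]] jet_value[OF b(1) coord[of z]]
      by (simp add: self differential_def Let_def g)
  qed
  \<comment> \<open>Here the multiplier is the canonoid factor \<open>\<beta>\<close>: Cartan's
    formula gives \<open>d\<alpha>(X, _) = dK - \<beta> \<alpha>\<close>.\<close>
  have tX: "t \<bullet> cross3 ?X z = 0" for z
    unfolding t_def
  proof (rule quot_curl_kernel[OF aX _ HK(2)])
    fix z
    show "d \<bullet> cross3 ?X z = k \<bullet> z - \<beta> p * (a ?x \<bullet> z)"
      using \<beta>[OF coord[of z]] lie[OF coord[of z]] jet_value[OF d(1) coord[of z]]
      by (simp add: self k d(2))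
  qed
  have "a ?x \<bullet> d = \<rho> p * (h ?x \<bullet> b)"
  proof -
    \<comment> \<open>On the coordinate basis the determinant is 1, so the wedges reduce to the
      inner products.\<close>
    let ?e = "\<lambda>i. coord_vec A ?c p (axis i 1)"
    have "wedge12 \<alpha> (ext_d A \<alpha>) p (?e 1) (?e 2) (?e 3) = \<rho> p * wedge12 \<eta> (ext_d A \<eta>) p (?e 1) (?e 2) (?e 3)"
      using volume[OF coord coord coord] pullback3_wedge12[OF smooth_\<Phi> one_form_\<eta> coord coord coord]
      by (simp add: \<alpha>_eq)
    then show ?thesis
      by (simp add: wedge12_jet[OF b(1) coord coord coord] wedge12_jet[OF d(1) coord coord coord]
          self cross_basis inner_axis_axis)
  qed
  \<comment> \<open>The densities are divided by the squares of \<open>K\<close> and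
    \<open>H\<close>, whence the factor \<open>(H p / K p)\<^sup>2\<close> in
    \<open>\<kappa>\<close>.\<close>
  then have st: "(- (1 / K p) *\<^sub>R a ?x) \<bullet> t = \<kappa> p * ((- (1 / H p) *\<^sub>R h ?x) \<bullet> m)"
    unfolding m_def t_def inner_quot_curl[OF HK(1)] inner_quot_curl[OF HK(2)]
    using HK by (simp add: \<kappa>_eq power_divide)
  have "t = \<kappa> p *\<^sub>R m"
    by (rule proportional_curls[OF _ mX _ tX st]) (simp_all add: hX aX HK)
  moreover have "jet lam p (- (1 / H p) *\<^sub>R h ?x) m"
    unfolding lam_eq m_def by (rule jet_divide[OF h b(2) H' HK(1)])
  moreover have "jet \<sigma> p (- (1 / K p) *\<^sub>R a ?x) t"
    unfolding \<sigma>_eq t_def by (rule jet_divide[OF a d(2) K'[unfolded k] HK(2)])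
  moreover have "(- (1 / H p) *\<^sub>R h ?x) \<bullet> m \<noteq> 0"
    unfolding m_def inner_quot_curl[OF HK(1)]
    using HK contact_jet_nonzero[OF contact b(1)] by simp
  ultimately show thesis
    using that mX by blast
qed

text \<open>\<open>\<kappa> P\<close> satisfies both equations that define \<open>N\<close>:
  \<open>P\<close> maps into the kernel of \<open>\<lambda>\<close>, and the multiple of
  \<open>X\<close> that it subtracts is invisible to \<open>d\<lambda>\<close>. Since
  \<open>\<lambda>\<close> is contact, these equations determine the vector.\<close>

lemma N_eq:
  assumes p: "p \<in> U" and v: "v \<in> tangent_space A p"
  shows "N p v = (\<lambda>c. \<kappa> p *\<^sub>R P p v c)"
proof -
  let ?c = "chart_at A p"
  obtain l m s where j: "jet lam p l m" "jet \<sigma> p s (\<kappa> p *\<^sub>R m)" "l \<bullet> m \<noteq> 0"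
    "\<And>z. m \<bullet> cross3 (X p ?c) z = 0"
    using jets[OF p] by blast
  have HK: "H p \<noteq> 0"
    using p U_eq by auto
  have Nv: "N p v \<in> tangent_space A p" "lam p (N p v) = 0"
    "\<And>z. z \<in> tangent_space A p \<Longrightarrow> ext_d A lam p (N p v) z = ext_d A \<sigma> p v z"
    using endo p v unfolding invariant_endo_def smooth_bundle_endo_def by blast+
  note Pv = P_in_tangent_space[OF v]
  \<comment> \<open>A scalar multiple is written as a \<open>tcomb\<close> with second coefficient
    0, so that the rules for \<open>tcomb\<close> apply.\<close>
  let ?w = "tcomb (\<kappa> p) (P p v) 0 (P p v)"
  have w: "?w \<in> tangent_space A p"
    using Pv by (simp add: tcomb_in_tangent_space)
  have "N p v = ?w"
  proof (rule jet_determines_vector[OF j(1,3) Nv(1) w])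
    show "lam p (N p v) = lam p ?w"
      using Nv(2) lam_P[OF HK v] Pv by (simp add: lam_tcomb)
    fix z
    assume z: "z \<in> tangent_space A p"
    have wc: "?w ?c = \<kappa> p *\<^sub>R v ?c - (\<kappa> p * lam p v) *\<^sub>R X p ?c"
      by (simp add: tcomb_apply P_eq algebra_simps)
    have "ext_d A lam p ?w z = \<kappa> p * (m \<bullet> cross3 (v ?c) (z ?c))"
      unfolding jet_ext_d[OF j(1) w z] wc
      by (simp add: Cross3.left_diff_distrib cross_mult_left inner_diff_right j(4))
    then show "ext_d A lam p (N p v) z = ext_d A lam p ?w z"
      using Nv(3)[OF z] by (simp add: jet_ext_d[OF j(2) v z])
  qed
  then show ?thesis
    by (simp add: tcomb_def)
qed

text \<open>On the image of \<open>P\<close> the form \<open>\<lambda>\<close> vanishes, so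
  \<open>P\<close> is the identity there and \<open>N\<close> is multiplication by
  \<open>\<kappa>\<close>. The exponent starts at 1 because the zeroth power is the identity, not
  \<open>P\<close>.\<close>

lemma N_power:
  assumes p: "p \<in> U" and v: "v \<in> tangent_space A p"
  shows "(N p ^^ Suc k) v = (\<lambda>c. \<kappa> p ^ Suc k *\<^sub>R P p v c)"
proof (induction k)
  case 0
  show ?case
    using N_eq[OF p v] by simp
next
  case (Suc k)
  let ?w = "tcomb (\<kappa> p ^ Suc k) (P p v) 0 (P p v)"
  have HK: "H p \<noteq> 0"
    using p U_eq by auto
  note Pv = P_in_tangent_space[OF v]
  have "?w \<in> tangent_space A p" "lam p ?w = 0"
    using Pv lam_P[OF HK v] by (simp_all add: tcomb_in_tangent_space lam_tcomb)
  then have "N p ?w = (\<lambda>c. \<kappa> p *\<^sub>R ?w c)"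
    using N_eq[OF p] by (simp add: P_eq tcomb_def)
  moreover have "(N p ^^ Suc k) v = ?w"
    using Suc.IH by (simp add: tcomb_def)
  ultimately show ?case
    by (simp add: tcomb_def)
qed

text \<open>The tensor product of \<open>X\<close> and \<open>\<lambda>\<close> has trace
  \<open>\<lambda>(X) = 1\<close>, so \<open>P\<close> has trace \<open>3 - 1\<close>. Any chart
  around \<open>p\<close> is allowed, because \<open>rank_traces\<close> keeps one chart fixed while
  the point varies.\<close>

lemma trace_N_power:
  assumes p: "p \<in> U" and c: "c \<in> charts_at A p"
  shows "trace (matrix (\<lambda>e. (N p ^^ Suc k) (coord_vec A c p e) c)) = 2 * \<kappa> p ^ Suc k"
proof -
  have HK: "H p \<noteq> 0"
    using p U_eq by auto
  interpret linear "\<lambda>e. lam p (coord_vec A c p e)"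
    by (rule form1_linear_coord[OF _ c]) (simp add: lam_tcomb)
  have "(\<Sum>i\<in>UNIV. lam p (coord_vec A c p (axis i 1)) * X p c $ i) =
      lam p (coord_vec A c p (\<Sum>i\<in>UNIV. X p c $ i *\<^sub>R axis i 1))"
    by (simp add: sum scaleR mult.commute)
  also have "\<dots> = 1"
    using basis_expansion[of "X p c"] lam_X[OF HK] coord_vec_component[OF X_in_tangent_space c]
    by (simp add: scalar_mult_eq_scaleR)
  finally have *: "(\<Sum>i\<in>UNIV. lam p (coord_vec A c p (axis i 1)) * X p c $ i) = 1" .
  have "trace (matrix (\<lambda>e. (N p ^^ Suc k) (coord_vec A c p e) c)) =
      (\<Sum>i\<in>UNIV. \<kappa> p ^ Suc k * (1 - lam p (coord_vec A c p (axis i 1)) * X p c $ i))"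
    unfolding trace_def matrix_def
    by (simp add: N_power[OF p coord_vec_in_tangent_space[OF c]] P_eq tcomb_apply coord_vec_self[OF c]
        axis_def del: funpow.simps)
  also have "\<dots> = \<kappa> p ^ Suc k * (3 - 1)"
    by (simp only: sum_distrib_left[symmetric] sum_subtractf *) simp
  finally show ?thesis
    by simp
qed

lemma endo_trace_N_power:
  assumes "p \<in> U" "1 \<le> k"
  shows "endo_trace A p (N p ^^ k) = 2 * \<kappa> p ^ k"
proof -
  obtain j where "k = Suc j"
    using assms(2) by (cases k) auto
  then show ?thesis
    using trace_N_power[OF assms(1) chart_at_in] by (simp add: endo_trace_def Let_def del: funpow.simps)
qed

text \<open>All differentials are multiples of \<open>d\<kappa>\<close>, by the chain rule for
  \<open>2 * \<kappa> ^ k\<close>. Differentiability of \<open>\<kappa>\<close> comes from the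
  smoothness of \<open>N\<close>, as half its trace, since nothing is assumed about the regularity
  of \<open>\<rho>\<close>.\<close>

lemma rank_traces:
  assumes p: "p \<in> U"
  shows "rank_of_differentials A p {\<lambda>q. endo_trace A q (N q ^^ k) |k. k \<ge> 1} \<le> 1"
proof -
  let ?c = "chart_at A p"
  let ?x = "cmap ?c p"
  note c = chart_at_in[of p]
  note cA = charts_atD[OF c]
  have px: "cinv ?c ?x = p"
    using cA by (simp add: cinv_cmap)
  obtain K' where K': "((K \<circ> cinv ?c) has_derivative K') (at ?x)"
    by (rule K_has_derivative)
  \<comment> \<open>Continuity of \<open>H K\<close> in the chart at \<open>?x\<close> provides a
    neighbourhood of \<open>?x\<close> that corresponds to points of \<open>U\<close>.\<close>
  define f where "f = (\<lambda>x. (H \<circ> cinv ?c) x * (K \<circ> cinv ?c) x)"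
  have "isCont f ?x"
    unfolding f_def
    using has_derivative_continuous[OF smooth_function_has_derivative[OF smooth_H c]]
      has_derivative_continuous[OF K'] by (intro continuous_intros)
  then have "(f \<longlongrightarrow> f ?x) (nhds ?x)"
    unfolding isCont_def tendsto_at_iff_tendsto_nhds .
  moreover have "f ?x \<noteq> 0"
    using p U_eq by (simp add: f_def px)
  ultimately have "\<forall>\<^sub>F x in nhds ?x. f x \<noteq> 0"
    by (rule tendsto_imp_eventually_ne)
  then have "\<forall>\<^sub>F x in nhds ?x. cinv ?c x \<in> U \<and> x \<in> cmap ?c ` cdom ?c"
    using eventually_in_chart[OF c] by eventually_elim (simp add: U_eq f_def)
  then obtain S where S: "open S" "?x \<in> S"
    and S': "\<And>x. x \<in> S \<Longrightarrow> cinv ?c x \<in> U \<and> x \<in> cmap ?c ` cdom ?c"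
    unfolding eventually_nhds by blast
  let ?M = "\<lambda>x. trace (matrix (\<lambda>e. N (cinv ?c x) (coord_vec A ?c (cinv ?c x) e) ?c))"
  have "smooth_on (cmap ?c ` (cdom ?c \<inter> U)) (\<lambda>x. N (cinv ?c x) (coord_vec A ?c (cinv ?c x) e) ?c)" for e
    using endo cA unfolding invariant_endo_def smooth_bundle_endo_def by blast
  then have D: "((\<lambda>x. N (cinv ?c x) (coord_vec A ?c (cinv ?c x) e) ?c) has_derivative
      frechet_derivative (\<lambda>x. N (cinv ?c x) (coord_vec A ?c (cinv ?c x) e) ?c) (at ?x)) (at ?x)" for e
    using cA p by (intro smooth_on_has_derivative) auto
  obtain M' where "(?M has_derivative M') (at ?x)"
  proof
    show "(?M has_derivative (\<lambda>u. \<Sum>i\<in>UNIV. frechet_derivative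
        (\<lambda>x. N (cinv ?c x) (coord_vec A ?c (cinv ?c x) (axis i 1)) ?c) (at ?x) u $ i)) (at ?x)"
      unfolding trace_def matrix_def vec_lambda_beta
      by (intro has_derivative_sum bounded_linear.has_derivative[OF bounded_linear_vec_nth D])
  qed
  then have "((\<lambda>x. ?M x / 2) has_derivative (\<lambda>u. M' u / 2)) (at ?x)"
    by (auto intro!: derivative_eq_intros)
  then have \<kappa>': "((\<lambda>x. \<kappa> (cinv ?c x)) has_derivative (\<lambda>u. M' u / 2)) (at ?x)"
  proof (rule has_derivative_transform_within_open[OF _ S])
    fix x
    assume "x \<in> S"
    then show "?M x / 2 = \<kappa> (cinv ?c x)"
      using trace_N_power[of "cinv ?c x" ?c 0] S'[of x] cinv_charts_at[OF cA(1)] by simp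
  qed
  \<comment> \<open>The components of \<open>d\<kappa>\<close> at \<open>p\<close>.\<close>
  define z :: "real^3" where "z = (\<chi> i. M' (axis i 1) / 2)"
  have "covector_components A p (differential A (\<lambda>q. endo_trace A q (N q ^^ k)) p) \<in> span {z}"
    if k: "k \<ge> 1" for k
  proof -
    have "((\<lambda>x. 2 * \<kappa> (cinv ?c x) ^ k) has_derivative
        (\<lambda>u. (2 * of_nat k * \<kappa> p ^ (k - 1)) * (M' u / 2))) (at ?x)"
      by (rule has_derivative_eq_rhs[OF has_derivative_mult_right[OF has_derivative_power[OF \<kappa>']]])
        (simp add: px fun_eq_iff)
    then have "((\<lambda>q. endo_trace A q (N q ^^ k)) \<circ> cinv ?c has_derivative
        (\<lambda>u. (2 * of_nat k * \<kappa> p ^ (k - 1)) * (M' u / 2))) (at ?x)"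
      by (rule has_derivative_transform_within_open[OF _ S])
        (use S' endo_trace_N_power[OF _ k] in simp)
    from frechet_derivative_at[OF this, symmetric]
    have "covector_components A p (differential A (\<lambda>q. endo_trace A q (N q ^^ k)) p) =
        (2 * of_nat k * \<kappa> p ^ (k - 1)) *\<^sub>R z"
      by (simp add: covector_components_def differential_def Let_def coord_vec_self[OF c] z_def vec_eq_iff)
    then show ?thesis
      by (simp add: span_base span_scale)
  qed
  then have "(\<lambda>f. covector_components A p (differential A f p)) `
      {\<lambda>q. endo_trace A q (N q ^^ k) |k. k \<ge> 1} \<subseteq> span {z}"
    by blast
  from dim_mono[OF this] show ?thesis
    using dim_le_card'[of "{z}"] unfolding rank_of_differentials_def by simp
qed

end

theorem corollary2:
  fixes A :: "('a::{t2_space, second_countable_topology}, 3) chart set"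
    and \<eta> \<alpha> lam \<sigma> :: "('a, 3) form1"
    and \<mu> :: "('a, 3) form3"
    and H K \<rho> \<kappa> :: "'a \<Rightarrow> real"
    and X :: "'a \<Rightarrow> ('a, 3) tvec"
    and \<Phi> :: "'a \<Rightarrow> 'a"
    and U :: "'a set"
    and P N :: "'a \<Rightarrow> ('a, 3) tvec \<Rightarrow> ('a, 3) tvec"
  assumes "contact_hamiltonian_system A \<eta> H"
    and "contact_canonoid A \<eta> H \<Phi>"
    and "contact_hamiltonian_field A \<eta> H X"
    and "\<mu> = wedge12 \<eta> (ext_d A \<eta>)"
    and "\<alpha> = pullback1 A \<Phi> \<eta>"
    and "K = (\<lambda>p. - \<alpha> p (X p))"
    and "\<And>p u v w. u \<in> tangent_space A p \<Longrightarrow> v \<in> tangent_space A p \<Longrightarrow> w \<in> tangent_space A p \<Longrightarrow>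
           pullback3 A \<Phi> \<mu> p u v w = \<rho> p * \<mu> p u v w"
    and "U = {p. H p * K p \<noteq> 0}"
    and "lam = (\<lambda>p v. - \<eta> p v / H p)"
    and "\<sigma> = (\<lambda>p v. - \<alpha> p v / K p)"
    and "P = (\<lambda>p v. tcomb 1 v (- lam p v) (X p))"
    and "\<kappa> = (\<lambda>p. \<rho> p * (H p / K p)\<^sup>2)"
    and "invariant_endo A U lam \<sigma> N"
  shows "(\<forall>p\<in>U. \<forall>v\<in>tangent_space A p. N p v = (\<lambda>c. \<kappa> p *\<^sub>R P p v c)) \<and>
    (\<forall>p\<in>U. \<forall>k\<ge>1. endo_trace A p (N p ^^ k) = 2 * \<kappa> p ^ k) \<and>
    (\<forall>p\<in>U. rank_of_differentials A p {\<lambda>q. endo_trace A q (N q ^^ k) |k. k \<ge> 1} \<le> 1)"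
proof -
  have "smooth_atlas A" "contact_form A \<eta>" "smooth_function A H"
    using assms(1) by (simp_all add: contact_hamiltonian_system_def)
  then interpret canonoid_system A \<eta> \<alpha> lam \<sigma> H K \<rho> \<kappa> X \<Phi> U P N
    by unfold_locales (assumption | rule assms(2,3,5,6,8-13) assms(7)[unfolded assms(4)])+
  show ?thesis
    using N_eq endo_trace_N_power rank_traces by blast
qed

end
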